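(* Let $G$ be a unicyclic graph. Then $G$ has exactly four distinct normalized Laplacian eigenvalues if and only if $G$ is one of: the cycle $C_6$, the cycle $C_7$, the graph $U_2(1)$ obtained from a triangle by attaching one pendant vertex to one of its vertices, or the graph $U_4(1,1,1)$ obtained from a triangle by attaching one pendant vertex to each of its three vertices.
   Context: A unicyclic graph is a connected graph with $n$ vertices and $n$ edges. $C_n$ denotes the cycle on $n$ vertices; a pendant vertex is a vertex of degree $1$. For a graph with adjacency matrix $A$ and diagonal degree matrix $D$ (no isolated vertices), the normalized Laplacian is $\mathcal{L}=I-D^{-1/2}AD^{-1/2}$, and its eigenvalues are the normalized Laplacian eigenvalues. *)

theory Defs
  imports Main "HOL-Analysis.Analysis"
begin

definition simple_graph :: "'a set \<Rightarrow> ('a \<Rightarrow> 'a \<Rightarrow> bool) \<Rightarrow> bool" where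
  "simple_graph V E \<longleftrightarrow> finite V \<and> (\<forall>u v. E u v \<longrightarrow> u \<in> V \<and> v \<in> V)
     \<and> (\<forall>u v. E u v \<longrightarrow> E v u) \<and> (\<forall>u. \<not> E u u)"

definition edge_set :: "('a \<Rightarrow> 'a \<Rightarrow> bool) \<Rightarrow> 'a set set" where
  "edge_set E = {{u, v} | u v. E u v}"

definition connected_graph :: "'a set \<Rightarrow> ('a \<Rightarrow> 'a \<Rightarrow> bool) \<Rightarrow> bool" where
  "connected_graph V E \<longleftrightarrow> V \<noteq> {} \<and> (\<forall>u\<in>V. \<forall>v\<in>V. E\<^sup>*\<^sup>* u v)"

definition unicyclic :: "'a set \<Rightarrow> ('a \<Rightarrow> 'a \<Rightarrow> bool) \<Rightarrow> bool" where
  "unicyclic V E \<longleftrightarrow> simple_graph V E \<and> connected_graph V E \<and> card (edge_set E) = card V"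

definition degree :: "'a set \<Rightarrow> ('a \<Rightarrow> 'a \<Rightarrow> bool) \<Rightarrow> 'a \<Rightarrow> nat" where
  "degree V E u = card {v \<in> V. E u v}"

text \<open>Normalized Laplacian  I - D^(-1/2) A D^(-1/2), indexed by V \<times> V.\<close>
definition norm_laplacian :: "'a set \<Rightarrow> ('a \<Rightarrow> 'a \<Rightarrow> bool) \<Rightarrow> 'a \<Rightarrow> 'a \<Rightarrow> real" where
  "norm_laplacian V E u v =
     (if u = v then 1 else 0)
     - (if E u v then 1 / sqrt (real (degree V E u) * real (degree V E v)) else 0)"

definition nl_eigenvalues :: "'a set \<Rightarrow> ('a \<Rightarrow> 'a \<Rightarrow> bool) \<Rightarrow> real set" where
  "nl_eigenvalues V E = {mu. \<exists>x :: 'a \<Rightarrow> real. (\<exists>v\<in>V. x v \<noteq> 0) \<and>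
      (\<forall>u\<in>V. (\<Sum>v\<in>V. norm_laplacian V E u v * x v) = mu * x u)}"

definition graph_iso :: "'a set \<Rightarrow> ('a \<Rightarrow> 'a \<Rightarrow> bool) \<Rightarrow> 'b set \<Rightarrow> ('b \<Rightarrow> 'b \<Rightarrow> bool) \<Rightarrow> bool" where
  "graph_iso V E W F \<longleftrightarrow> (\<exists>f. bij_betw f V W \<and> (\<forall>u\<in>V. \<forall>v\<in>V. E u v \<longleftrightarrow> F (f u) (f v)))"

definition cycle_V :: "nat \<Rightarrow> nat set" where "cycle_V n = {0..<n}"
definition cycle_E :: "nat \<Rightarrow> nat \<Rightarrow> nat \<Rightarrow> bool" where
  "cycle_E n u v \<longleftrightarrow> u < n \<and> v < n \<and> u \<noteq> v \<and> (v = (u + 1) mod n \<or> u = (v + 1) mod n)"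

definition U21_V :: "nat set" where "U21_V = {0,1,2,3}"
definition U21_E :: "nat \<Rightarrow> nat \<Rightarrow> bool" where
  "U21_E u v \<longleftrightarrow> {u, v} \<in> {{0,1},{1,2},{0,2},{0,3}}"

definition U4111_V :: "nat set" where "U4111_V = {0,1,2,3,4,5}"
definition U4111_E :: "nat \<Rightarrow> nat \<Rightarrow> bool" where
  "U4111_E u v \<longleftrightarrow> {u, v} \<in> {{0,1},{1,2},{0,2},{0,3},{1,4},{2,5}}"

end

theory Submission
  imports Defs "HOL-Computational_Algebra.Polynomial"
begin

text \<open>Four eigenvalues give a cubic polynomial in the random walk matrix P with value a multiple of the
  rank one matrix of the stationary distribution. Read entrywise this is an identity between weighted
  counts of walks of length at most three. If there is no pendant vertex, the graph is a cycle, whose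
  eigenvalues are explicit. Otherwise the row of a pendant vertex at w shows that all vertices are within
  distance two of w, so that the graph is a tree of depth two rooted at w plus one extra edge. The
  position of that edge relative to the levels of the tree leaves three cases, and the identity at a few
  entries excludes everything but the two triangle graphs.\<close>

section \<open>The random walk operator\<close>

text \<open>Connectedness makes 1 a simple eigenvalue, with the constants as eigenspace. The product
  of the factors of the three other eigenvalues is therefore a multiple of the projection onto the
  constants, and the multiple \<open>k\<close> is nonzero because these three differ from 1. So no
  entry of the rank one side vanishes. A pendant vertex spends its first step going to w, which
  leaves two of the three steps; this is where distance two comes from. No vertex degree is bounded
  in advance, and \<open>k\<close> and the coefficients of the cubic are unknown. The entries
  compared are those from which the unknowns can be eliminated; what remains usually forces w to
  have degree 2, while w has at least three neighbours. Passing from the normalized Laplacian to P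
  removes the square roots: \<open>walk_eigenvalues\<close> is the generalized problem A g = c D g,
  written without division.\<close>

definition walk_eigenvalues :: "'a set \<Rightarrow> ('a \<Rightarrow> 'a \<Rightarrow> bool) \<Rightarrow> real set" where
  "walk_eigenvalues V E = {c. \<exists>g :: 'a \<Rightarrow> real. (\<exists>v\<in>V. g v \<noteq> 0) \<and>
      (\<forall>u\<in>V. (\<Sum>v\<in>{v\<in>V. E u v}. g v) = c * real (degree V E u) * g u)}"

text \<open>The substitution x = D^(1/2) g turns L x = mu x into A g = (1 - mu) D g. Positive
  degrees make it invertible, so nonzero vectors correspond to nonzero vectors.\<close>

lemma nl_eigenvalues_eq_walk_eigenvalues:
  fixes V :: "'a set"
  assumes fin: "finite V" and pos: "\<And>u. u \<in> V \<Longrightarrow> degree V E u > 0"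
  shows "nl_eigenvalues V E = (\<lambda>c. 1 - c) ` walk_eigenvalues V E"
proof -
  define r where "r u = sqrt (real (degree V E u))" for u
  have r0: "r u > 0" and rr: "r u * r u = real (degree V E u)" if "u \<in> V" for u
    using pos[OF that] by (auto simp: r_def)
  have lap: "(\<Sum>v\<in>V. norm_laplacian V E u v * x v) = x u - (\<Sum>v\<in>{v\<in>V. E u v}. x v / r v) / r u"
    if "u \<in> V" for u and x :: "'a \<Rightarrow> real"
  proof -
    have "(\<Sum>v\<in>V. norm_laplacian V E u v * x v)
        = (\<Sum>v\<in>V. (if u = v then x v else 0) - (if E u v then x v / r v / r u else 0))"
      by (intro sum.cong refl) (auto simp: norm_laplacian_def r_def real_sqrt_mult algebra_simps)
    also have "\<dots> = x u - (\<Sum>v\<in>V. if E u v then x v / r v / r u else 0)"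
      using fin that by (simp add: sum_subtractf)
    also have "(\<Sum>v\<in>V. if E u v then x v / r v / r u else 0) = (\<Sum>v\<in>{v\<in>V. E u v}. x v / r v / r u)"
      using fin by (simp only: sum.inter_filter)
    finally show ?thesis by (simp add: sum_divide_distrib)
  qed
  show ?thesis
  proof (intro equalityI subsetI)
    fix mu assume "mu \<in> nl_eigenvalues V E"
    then obtain x v0 where v0: "v0 \<in> V" "x v0 \<noteq> 0"
      and x: "\<And>u. u \<in> V \<Longrightarrow> (\<Sum>v\<in>V. norm_laplacian V E u v * x v) = mu * x u"
      unfolding nl_eigenvalues_def by blast
    have "(\<Sum>v\<in>{v\<in>V. E u v}. x v / r v) = (1 - mu) * real (degree V E u) * (x u / r u)" if "u \<in> V" for u
    proof -
      have "(\<Sum>v\<in>{v\<in>V. E u v}. x v / r v) = (1 - mu) * x u * r u"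
        using x[OF that] r0[OF that] unfolding lap[OF that] by (simp add: field_simps)
      then show ?thesis using r0[OF that] unfolding rr[OF that, symmetric] by simp
    qed
    moreover have "x v0 / r v0 \<noteq> 0" using v0 r0 by force
    ultimately have "1 - mu \<in> walk_eigenvalues V E"
      unfolding walk_eigenvalues_def using v0(1) by (intro CollectI exI[of _ "\<lambda>v. x v / r v"]) blast
    then show "mu \<in> (\<lambda>c. 1 - c) ` walk_eigenvalues V E"
      by (intro image_eqI[of _ _ "1 - mu"]) auto
  next
    fix mu assume "mu \<in> (\<lambda>c. 1 - c) ` walk_eigenvalues V E"
    then obtain c g v0 where mu: "mu = 1 - c" and v0: "v0 \<in> V" "g v0 \<noteq> 0"
      and g: "\<And>u. u \<in> V \<Longrightarrow> (\<Sum>v\<in>{v\<in>V. E u v}. g v) = c * real (degree V E u) * g u"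
      unfolding walk_eigenvalues_def by blast
    have "(\<Sum>v\<in>V. norm_laplacian V E u v * (r v * g v)) = mu * (r u * g u)" if "u \<in> V" for u
    proof -
      have "(\<Sum>v\<in>{v\<in>V. E u v}. r v * g v / r v) = (\<Sum>v\<in>{v\<in>V. E u v}. g v)"
        by (intro sum.cong refl) (use r0 in force)
      then show ?thesis
        using g[OF that] r0[OF that] unfolding lap[OF that] rr[OF that, symmetric] mu
        by (simp add: field_simps)
    qed
    moreover have "r v0 * g v0 \<noteq> 0" using v0 r0 by force
    ultimately show "mu \<in> nl_eigenvalues V E"
      unfolding nl_eigenvalues_def using v0(1) by (intro CollectI exI[of _ "\<lambda>v. r v * g v"]) blast
  qed
qed

lemma walk_eigenvalues_graph_iso:
  assumes "graph_iso V E W F"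
  shows "walk_eigenvalues V E = walk_eigenvalues W F"
proof -
  obtain f where f: "bij_betw f V W" and EF: "\<And>u v. u \<in> V \<Longrightarrow> v \<in> V \<Longrightarrow> E u v \<longleftrightarrow> F (f u) (f v)"
    using assms unfolding graph_iso_def by blast
  have nb: "bij_betw f {v\<in>V. E u v} {v\<in>W. F (f u) v}" if "u \<in> V" for u
    using f EF[OF that] by (auto simp: bij_betw_def inj_on_def)
  have dg: "degree W F (f u) = degree V E u" if "u \<in> V" for u
    using bij_betw_same_card[OF nb[OF that]] by (simp add: degree_def)
  have sm: "(\<Sum>v\<in>{v\<in>W. F (f u) v}. g v) = (\<Sum>v\<in>{v\<in>V. E u v}. g (f v))" if "u \<in> V" for u and g :: "'b \<Rightarrow> real"
    using sum.reindex_bij_betw[OF nb[OF that], of g] by simp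
  have WV: "W = f ` V" using f by (simp add: bij_betw_def)
  have "c \<in> walk_eigenvalues V E" if "c \<in> walk_eigenvalues W F" for c
  proof -
    obtain g where g: "\<exists>v\<in>W. g v \<noteq> 0"
      "\<forall>u\<in>W. (\<Sum>v\<in>{v\<in>W. F u v}. g v) = c * real (degree W F u) * g u"
      using \<open>c \<in> walk_eigenvalues W F\<close> unfolding walk_eigenvalues_def by blast
    have "f u \<in> W" if "u \<in> V" for u using that by (simp add: WV)
    then have "\<forall>u\<in>V. (\<Sum>v\<in>{v\<in>V. E u v}. g (f v)) = c * real (degree V E u) * g (f u)"
      using g(2) by (simp add: dg[symmetric] sm[symmetric])
    moreover have "\<exists>v\<in>V. g (f v) \<noteq> 0" using g(1) by (simp add: WV)
    ultimately show ?thesis unfolding walk_eigenvalues_def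
      by (intro CollectI exI[of _ "\<lambda>v. g (f v)"] conjI)
  qed
  moreover have "c \<in> walk_eigenvalues W F" if "c \<in> walk_eigenvalues V E" for c
  proof -
    obtain g where g: "\<exists>v\<in>V. g v \<noteq> 0"
      "\<forall>u\<in>V. (\<Sum>v\<in>{v\<in>V. E u v}. g v) = c * real (degree V E u) * g u"
      using \<open>c \<in> walk_eigenvalues V E\<close> unfolding walk_eigenvalues_def by blast
    have inv: "inv_into V f (f v) = v" if "v \<in> V" for v
      using f that by (simp add: bij_betw_def)
    have "(\<Sum>v\<in>{v\<in>W. F (f u) v}. g (inv_into V f v)) = c * real (degree W F (f u)) * g (inv_into V f (f u))"
      if "u \<in> V" for u
    proof -
      have "(\<Sum>v\<in>{v\<in>V. E u v}. g (inv_into V f (f v))) = (\<Sum>v\<in>{v\<in>V. E u v}. g v)"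
        using inv by (intro sum.cong) auto
      then show ?thesis using g(2) that by (simp add: sm dg inv)
    qed
    then show ?thesis unfolding walk_eigenvalues_def
      by (intro CollectI exI[of _ "\<lambda>v. g (inv_into V f v)"]) (use g(1) inv in \<open>auto simp: WV\<close>)
  qed
  ultimately show ?thesis by blast
qed

locale fin_graph =
  fixes V :: "'a set" and E :: "'a \<Rightarrow> 'a \<Rightarrow> bool"
  assumes simple: "simple_graph V E"
begin

definition nb :: "'a \<Rightarrow> 'a set" where "nb u = {v \<in> V. E u v}"
definition d :: "'a \<Rightarrow> real" where "d u = real (degree V E u)"

lemma fin: "finite V" and adj_V: "E u v \<Longrightarrow> u \<in> V \<and> v \<in> V"
  and adj_sym: "E u v \<Longrightarrow> E v u" and adj_irrefl [simp]: "\<not> E u u"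
  using simple by (auto simp: simple_graph_def)

lemma nb_iff [simp]: "v \<in> nb u \<longleftrightarrow> E u v"
  using adj_V by (auto simp: nb_def)

lemma adj_commute: "E u v \<longleftrightarrow> E v u" using adj_sym by blast

lemma finite_nb [simp]: "finite (nb u)" using fin by (simp add: nb_def)

lemma d_eq_card: "d u = real (card (nb u))" by (simp add: d_def degree_def nb_def)

lemma d_pos: "E u v \<Longrightarrow> d u > 0"
  by (auto simp: d_eq_card card_gt_0_iff)

text \<open>Self-adjointness is with respect to the degree weights, so that no square roots occur.\<close>

definition walk :: "('a \<Rightarrow> real) \<Rightarrow> 'a \<Rightarrow> real" where
  "walk g u = (\<Sum>v\<in>nb u. g v) / d u"

definition ip :: "('a \<Rightarrow> real) \<Rightarrow> ('a \<Rightarrow> real) \<Rightarrow> real" where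
  "ip f g = (\<Sum>u\<in>V. d u * f u * g u)"

text \<open>Entries of A D^-1 A, and for \<open>W3\<close> of A D^-1 A D^-1 A. The leading D^-1 of
  the powers of P is left out, so these weighted walk counts are symmetric in their
  arguments.\<close>

definition W2 :: "'a \<Rightarrow> 'a \<Rightarrow> real" where
  "W2 u v = (\<Sum>x\<in>nb u \<inter> nb v. 1 / d x)"

definition W3 :: "'a \<Rightarrow> 'a \<Rightarrow> real" where
  "W3 u v = (\<Sum>x\<in>nb u. W2 x v / d x)"

definition eigenfun :: "real \<Rightarrow> ('a \<Rightarrow> real) \<Rightarrow> bool" where
  "eigenfun c g \<longleftrightarrow> (\<forall>u\<in>V. walk g u = c * g u)"

lemma walk_lin: "walk (\<lambda>u. f u + t * g u) = (\<lambda>u. walk f u + t * walk g u)"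
  by (simp add: walk_def sum.distrib sum_distrib_left[symmetric] add_divide_distrib fun_eq_iff)

lemma ip_commute: "ip f g = ip g f" by (simp add: ip_def algebra_simps)

lemma ip_lin: "ip (\<lambda>u. f u + t * g u) h = ip f h + t * ip g h"
  by (simp add: ip_def sum.distrib sum_distrib_left algebra_simps)

lemma ip_lin_right: "ip h (\<lambda>u. f u + t * g u) = ip h f + t * ip h g"
  by (simp add: ip_def sum.distrib sum_distrib_left algebra_simps)

lemma ip_scale: "ip (\<lambda>u. t * f u) g = t * ip f g"
  by (simp add: ip_def sum_distrib_left algebra_simps)

text \<open>The weight \<open>d u\<close> cancels the denominator of \<open>walk\<close>, so both
  sides are sums over ordered adjacent pairs, and adjacency is symmetric.\<close>

lemma walk_self_adjoint: "ip (walk f) g = ip f (walk g)"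
proof -
  have *: "ip (walk f) g = (\<Sum>u\<in>V. \<Sum>v\<in>V. if E u v then f v * g u else 0)" for f g
  proof -
    \<comment> \<open>At a vertex of degree 0 division yields 0, which agrees with the empty
      neighbour sum.\<close>
    have "d u * walk f u = (\<Sum>v\<in>nb u. f v)" for u
      by (cases "d u = 0") (auto simp: walk_def d_eq_card)
    moreover have "(\<Sum>v\<in>nb u. f v) = (\<Sum>v\<in>V. if E u v then f v else 0)" for u
      using fin by (simp add: nb_def sum.inter_filter)
    ultimately show ?thesis
      by (simp add: ip_def sum_distrib_right if_distrib cong: if_cong)
         (intro sum.cong refl, auto)
  qed
  show ?thesis
    unfolding * ip_commute[of f "walk g"]
    by (rule trans[OF sum.swap]) (intro sum.cong refl, metis adj_sym mult.commute)
qed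

lemma walk_cong: "(\<And>u. u \<in> V \<Longrightarrow> f u = g u) \<Longrightarrow> walk f = walk g"
  unfolding walk_def fun_eq_iff using adj_V by (auto intro!: sum.cong arg_cong2[where f="(/)"])

lemma ip_cong: "(\<And>u. u \<in> V \<Longrightarrow> f u = f' u) \<Longrightarrow> (\<And>u. u \<in> V \<Longrightarrow> g u = g' u) \<Longrightarrow> ip f g = ip f' g'"
  by (simp add: ip_def)

end

section \<open>Completeness of the eigenfunctions of the walk operator\<close>

locale positive_graph = fin_graph +
  assumes d_pos_V: "\<And>u. u \<in> V \<Longrightarrow> d u > 0"
begin

lemma ip_nonneg: "ip f f \<ge> 0"
  unfolding ip_def using d_pos_V by (intro sum_nonneg) (simp add: mult.assoc less_imp_le)

lemma ip_self_eq_0: "ip f f = 0 \<longleftrightarrow> (\<forall>u\<in>V. f u = 0)"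
proof -
  have "ip f f = 0 \<longleftrightarrow> (\<forall>u\<in>V. d u * f u * f u = 0)"
    unfolding ip_def using fin d_pos_V by (intro sum_nonneg_eq_0_iff) (auto simp: mult.assoc less_imp_le)
  then show ?thesis using d_pos_V by force
qed

text \<open>Functions on the whole type carry the product topology; each expression is a polynomial
  in the finitely many coordinates indexed by \<open>V\<close>.\<close>

lemma continuous_on_ip: "continuous_on S (\<lambda>x. ip x f)" "continuous_on S (\<lambda>x. ip x x)"
  "continuous_on S (\<lambda>x. ip (walk x) x)"
  unfolding ip_def walk_def divide_inverse
  by (intro continuous_intros continuous_on_subset[OF continuous_on_product_coordinates subset_UNIV])+

text \<open>A maximiser of the Rayleigh quotient on the orthogonal complement of all eigenfunctions would be
  an eigenfunction orthogonal to itself.\<close>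

lemma eigenfun_total:
  assumes orth: "\<And>c e. eigenfun c e \<Longrightarrow> ip f e = 0" and "u \<in> V"
  shows "f u = 0"
proof (rule ccontr)
  assume "f u \<noteq> 0"
  then have ff: "ip f f > 0" using ip_self_eq_0[of f] ip_nonneg[of f] \<open>u \<in> V\<close> by force
  define W where "W = {x. \<forall>c e. eigenfun c e \<longrightarrow> ip x e = 0}"
  \<comment> \<open>The unit sphere of \<open>W\<close> need not be compact, as coordinates outside
    \<open>V\<close> are free. Pinning these to 0 and using that each term of \<open>ip x x\<close>
    is at most 1 puts it into a product of compact sets.\<close>
  define K where "K = {x \<in> W. ip x x = 1} \<inter> (Pi\<^sub>E UNIV (\<lambda>v. if v \<in> V then {- (1 / sqrt (d v))..1 / sqrt (d v)} else {0}))"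
  have "compact (Pi\<^sub>E UNIV (\<lambda>v. if v \<in> V then {- (1 / sqrt (d v))..1 / sqrt (d v)} else {0}))"
    unfolding compactin_euclidean_iff[symmetric] euclidean_product_topology[symmetric]
    by (subst compactin_PiE) auto
  moreover have "closed {x \<in> W. ip x x = 1}"
  proof -
    have "{x \<in> W. ip x x = 1} = (\<Inter>e\<in>{e. \<exists>c. eigenfun c e}. {x. ip x e = 0}) \<inter> {x. ip x x = 1}"
      by (auto simp: W_def)
    moreover have "closed {x. ip x e = 0}" "closed {x. ip x x = 1}" for e
      by (intro closed_Collect_eq continuous_on_ip continuous_on_const)+
    ultimately show ?thesis by (simp add: closed_Int closed_INT)
  qed
  ultimately have "compact K" unfolding K_def by (intro closed_Int_compact)
  \<comment> \<open>Nothing is lost by restricting to \<open>K\<close>: only the values on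
    \<open>V\<close> matter for the quotient.\<close>
  have inK: "\<exists>y\<in>K. \<forall>v\<in>V. y v = x v" if "x \<in> W" "ip x x = 1" for x
  proof
    let ?y = "\<lambda>v. if v \<in> V then x v else 0"
    have "ip ?y e = ip x e" "ip ?y ?y = ip x x" for e by (auto intro: ip_cong)
    moreover have "\<bar>x v\<bar> \<le> 1 / sqrt (d v)" if "v \<in> V" for v
    proof -
      have "d v * x v * x v \<le> ip x x"
        unfolding ip_def using that fin d_pos_V
        by (intro member_le_sum) (auto simp: mult.assoc less_imp_le)
      then have "(sqrt (d v) * \<bar>x v\<bar>)\<^sup>2 \<le> 1"
        using \<open>ip x x = 1\<close> d_pos_V[OF that] by (simp add: power_mult_distrib power2_eq_square[of "x v"] mult.assoc)
      then have "sqrt (d v) * \<bar>x v\<bar> \<le> 1" using power2_le_imp_le[of "sqrt (d v) * \<bar>x v\<bar>" 1] by simp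
      then show ?thesis using d_pos_V[OF that] by (simp add: pos_le_divide_eq mult.commute)
    qed
    moreover from this have "x v \<le> 1 / sqrt (d v)" "- (1 / sqrt (d v)) \<le> x v" if "v \<in> V" for v
      using that by (simp_all only: abs_le_iff) (simp add: minus_le_iff)
    ultimately show "?y \<in> K" using that unfolding K_def W_def by (simp add: PiE_iff)
    show "\<forall>v\<in>V. ?y v = x v" by simp
  qed
  have normalize: "(\<lambda>v. (1 / sqrt (ip x x)) * x v) \<in> W"
      "ip (\<lambda>v. (1 / sqrt (ip x x)) * x v) (\<lambda>v. (1 / sqrt (ip x x)) * x v) = 1" if "x \<in> W" "ip x x > 0" for x
  proof -
    show "(\<lambda>v. (1 / sqrt (ip x x)) * x v) \<in> W" using that(1) unfolding W_def by (simp only: mem_Collect_eq ip_scale) simp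
    show "ip (\<lambda>v. (1 / sqrt (ip x x)) * x v) (\<lambda>v. (1 / sqrt (ip x x)) * x v) = 1"
      unfolding ip_scale ip_commute[of x "\<lambda>v. (1 / sqrt (ip x x)) * x v"] using that(2) by simp
  qed
  have "f \<in> W" using orth by (simp add: W_def)
  then have "K \<noteq> {}" using inK[OF normalize] ff by blast
  then obtain x0 where x0: "x0 \<in> K" and max: "\<And>y. y \<in> K \<Longrightarrow> ip (walk y) y \<le> ip (walk x0) x0"
    using continuous_attains_sup[OF \<open>compact K\<close> _ continuous_on_ip(3)] by blast
  define M where "M = ip (walk x0) x0"
  have x0W: "x0 \<in> W" "ip x0 x0 = 1" using x0 by (auto simp: K_def)
  have bound: "ip (walk h) h \<le> M * ip h h" if hW: "h \<in> W" for h
  proof (cases "ip h h = 0")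
    case True
    then have "\<forall>v\<in>V. h v = 0" using ip_self_eq_0 by blast
    then have "ip (walk h) h = 0" by (simp add: ip_def)
    then show ?thesis using True by simp
  next
    case False
    then have pos: "ip h h > 0" using ip_nonneg[of h] by linarith
    let ?s = "1 / sqrt (ip h h)"
    obtain y where y: "y \<in> K" "\<forall>v\<in>V. y v = ?s * h v"
      using inK[OF normalize[OF hW pos]] by blast
    \<comment> \<open>The \<open>0 +\<close> gives scaling the shape f + t g that the linearity
      lemmas expect.\<close>
    have wy: "walk y = walk (\<lambda>v. 0 + ?s * h v)" using y(2) by (intro walk_cong) auto
    have "walk (\<lambda>v. 0 + ?s * h v) = (\<lambda>v. ?s * walk h v)" unfolding walk_lin by (simp add: walk_def)
    then have "ip (walk y) y = ip (\<lambda>v. ?s * walk h v) (\<lambda>v. ?s * h v)"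
      using y(2) wy by (intro ip_cong) auto
    also have "\<dots> = ip (walk h) h / ip h h"
      unfolding ip_scale ip_commute[of "walk h" "\<lambda>v. ?s * h v"] using pos
      by (simp add: ip_commute)
    finally have "ip (walk h) h / ip h h \<le> M" using max[OF y(1)] by (simp add: M_def)
    then show ?thesis using pos by (simp add: field_simps)
  qed
  \<comment> \<open>The residual of the maximiser, which is to be shown to vanish on
    \<open>V\<close>.\<close>
  define h where "h = (\<lambda>v. walk x0 v + (- M) * x0 v)"
  have walk_W: "walk x \<in> W" if "x \<in> W" for x
  proof -
    have "ip (walk x) e = 0" if "eigenfun c e" for c e
    proof -
      have "ip (walk x) e = ip x (\<lambda>v. 0 + c * e v)"
        unfolding walk_self_adjoint using that by (intro ip_cong) (auto simp: eigenfun_def)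
      also have "\<dots> = c * ip x e" unfolding ip_lin_right by (simp add: ip_def)
      finally show ?thesis using that \<open>x \<in> W\<close> by (auto simp: W_def)
    qed
    then show ?thesis by (simp add: W_def)
  qed
  have lin_W: "(\<lambda>v. x v + t * y v) \<in> W" if "x \<in> W" "y \<in> W" for x y t
    using that unfolding W_def by (auto simp: ip_lin)
  have hW: "h \<in> W" unfolding h_def by (intro lin_W walk_W x0W)
  have hh: "ip (walk x0) h - M * ip x0 h = ip h h"
    by (subst (3) h_def) (simp only: ip_lin)
  \<comment> \<open>Perturbing \<open>x0\<close> in the direction \<open>h\<close> changes the
    functional to first order by twice the squared norm of \<open>h\<close>, which maximality does
    not allow unless that norm is 0.\<close>
  have quad: "2 * t * ip h h + t\<^sup>2 * (ip (walk h) h - M * ip h h) \<le> 0" for t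
  proof -
    have "ip (walk (\<lambda>v. x0 v + t * h v)) (\<lambda>v. x0 v + t * h v) \<le> M * ip (\<lambda>v. x0 v + t * h v) (\<lambda>v. x0 v + t * h v)"
      by (intro bound lin_W x0W hW)
    moreover have "ip (walk (\<lambda>v. x0 v + t * h v)) (\<lambda>v. x0 v + t * h v) = M + 2 * t * ip (walk x0) h + t\<^sup>2 * ip (walk h) h"
      unfolding walk_lin ip_lin ip_lin_right M_def walk_self_adjoint[of h x0] ip_commute[of h "walk x0"]
      by (simp add: algebra_simps power2_eq_square)
    moreover have "ip (\<lambda>v. x0 v + t * h v) (\<lambda>v. x0 v + t * h v) = 1 + 2 * t * ip x0 h + t\<^sup>2 * ip h h"
      unfolding ip_lin ip_lin_right x0W(2) ip_commute[of h x0] by (simp add: algebra_simps power2_eq_square)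
    ultimately show ?thesis unfolding hh[symmetric] by (simp add: algebra_simps)
  qed
  have "ip h h = 0"
  proof (rule ccontr)
    assume "ip h h \<noteq> 0"
    then have pos: "ip h h > 0" using ip_nonneg[of h] by linarith
    define B where "B = M * ip h h - ip (walk h) h"
    have B0: "B \<ge> 0" using bound[OF hW] by (simp add: B_def)
    \<comment> \<open>Small enough that the quadratic term \<open>t * B\<close> stays below
      \<open>ip h h\<close>, half of the linear one.\<close>
    define t where "t = ip h h / (B + 1)"
    have t0: "t > 0" using pos B0 by (simp add: t_def)
    have "t * (2 * ip h h - t * B) \<le> 0"
      using quad[of t] by (simp add: B_def algebra_simps power2_eq_square)
    then have "2 * ip h h \<le> t * B" using t0 by (simp add: mult_le_0_iff)
    also have "t * B \<le> ip h h" using pos B0 by (simp add: t_def field_simps)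
    finally show False using pos by simp
  qed
  then have "eigenfun M x0" unfolding ip_self_eq_0 by (simp add: h_def eigenfun_def)
  then show False using x0W by (auto simp: W_def)
qed

end

text \<open>The assumption \<open>edges\<close> rules out the single isolated vertex; together with
  connectedness it makes every degree positive.\<close>

locale conn_graph = fin_graph +
  assumes conn: "connected_graph V E" and edges: "edge_set E \<noteq> {}"
begin

text \<open>Connectedness in the form in which it is applied: membership spreads along a path from
  any point of \<open>S\<close>.\<close>

lemma adj_closed_eq_V:
  assumes "S \<subseteq> V" "S \<noteq> {}" "\<And>u v. u \<in> S \<Longrightarrow> E u v \<Longrightarrow> v \<in> S"
  shows "S = V"
proof -
  obtain u where u: "u \<in> S" using assms(2) by blast
  have "v \<in> S" if "v \<in> V" for v
  proof -
    have "E\<^sup>*\<^sup>* u v" using conn u assms(1) that by (auto simp: connected_graph_def)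
    then show ?thesis by (induction rule: rtranclp_induct) (use u assms(3) in auto)
  qed
  then show ?thesis using assms(1) by blast
qed

lemma ex_adj: "u \<in> V \<Longrightarrow> \<exists>v. E u v"
proof (rule ccontr)
  assume "u \<in> V" "\<nexists>v. E u v"
  then have "V = {u}" using adj_closed_eq_V[of "{u}"] by blast
  moreover obtain x y where "E x y" using edges by (auto simp: edge_set_def)
  ultimately show False using adj_V[of x y] adj_irrefl[of u] by auto
qed

end

sublocale conn_graph \<subseteq> positive_graph
  by unfold_locales (use ex_adj d_pos in blast)

section \<open>The cubic identity of the walk matrix\<close>

context conn_graph
begin

lemma walk_eigenvalues_eq: "walk_eigenvalues V E = {c. \<exists>g. (\<exists>v\<in>V. g v \<noteq> 0) \<and> eigenfun c g}"
proof -
  have "(\<Sum>v\<in>{v\<in>V. E u v}. g v) = c * real (degree V E u) * g u \<longleftrightarrow> walk g u = c * g u"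
    if "u \<in> V" for u g c
    using d_pos_V[OF that] by (auto simp: walk_def nb_def d_def field_simps)
  then show ?thesis unfolding walk_eigenvalues_def eigenfun_def by simp
qed

text \<open>Maximum principle: an average of values at most \<open>m\<close> equals \<open>m\<close>
  only if all of them do, so the set where the maximum is attained is closed under
  adjacency.\<close>

lemma harmonic_const:
  assumes h: "\<And>u. u \<in> V \<Longrightarrow> walk g u = g u"
  shows "\<exists>c. \<forall>u\<in>V. g u = c"
proof -
  define m where "m = Max (g ` V)"
  have "V \<noteq> {}" using conn by (simp add: connected_graph_def)
  then have le: "g u \<le> m" if "u \<in> V" for u using fin that by (simp add: m_def)
  have "m \<in> g ` V" unfolding m_def using fin \<open>V \<noteq> {}\<close> by (intro Max_in) auto
  have "{u \<in> V. g u = m} = V"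
  proof (rule adj_closed_eq_V)
    fix u v assume u: "u \<in> {u \<in> V. g u = m}" and "E u v"
    then have uV: "u \<in> V" and gu: "g u = m" by auto
    have "(\<Sum>v\<in>nb u. g v) = d u * m" using h[OF uV] d_pos_V[OF uV] gu by (simp add: walk_def field_simps)
    then have "(\<Sum>v\<in>nb u. m - g v) = 0" by (simp add: sum_subtractf d_eq_card)
    moreover have "0 \<le> m - g v" if "v \<in> nb u" for v using le[of v] adj_V[of u v] that by simp
    ultimately have "\<forall>v\<in>nb u. m - g v = 0" using sum_nonneg_eq_0_iff[of "nb u" "\<lambda>v. m - g v"] by simp
    then show "v \<in> {u \<in> V. g u = m}" using \<open>E u v\<close> adj_V by force
  qed (use \<open>m \<in> g ` V\<close> in auto)
  then show ?thesis by blast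
qed

text \<open>The operator P - a, written as a sum with factor \<open>- a\<close> so that the
  linearity lemmas apply to it.\<close>

definition shift :: "real \<Rightarrow> ('a \<Rightarrow> real) \<Rightarrow> 'a \<Rightarrow> real" where
  "shift a f = (\<lambda>u. walk f u + (- a) * f u)"

lemma shift_self_adjoint: "ip (shift a f) g = ip f (shift a g)"
  by (simp only: shift_def ip_lin ip_lin_right walk_self_adjoint)

lemma ip_shift_eigenfun:
  assumes "eigenfun c e"
  shows "ip (shift a f) e = (c - a) * ip f e"
proof -
  have "ip (shift a f) e = ip f (\<lambda>v. 0 + (c - a) * e v)"
    unfolding shift_self_adjoint using assms by (intro ip_cong) (auto simp: shift_def eigenfun_def algebra_simps)
  then show ?thesis unfolding ip_lin_right by (simp add: ip_def)
qed

definition delta :: "'a \<Rightarrow> 'a \<Rightarrow> real" where "delta v u = (if u = v then 1 else 0)"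

lemma ip_delta: "v \<in> V \<Longrightarrow> ip f (delta v) = d v * f v"
  using fin by (simp add: ip_def delta_def if_distrib cong: if_cong)

lemma walk_delta: "v \<in> V \<Longrightarrow> walk (delta v) = (\<lambda>u. (if E u v then 1 else 0) / d u)"
  by (auto simp: walk_def delta_def fun_eq_iff)

lemma walk2_delta: "v \<in> V \<Longrightarrow> walk (walk (delta v)) = (\<lambda>u. W2 u v / d u)"
  unfolding walk_delta
proof
  fix u
  have "(\<Sum>x\<in>nb u. (if E x v then 1 else 0) / d x) = (\<Sum>x\<in>nb u. if x \<in> nb v then 1 / d x else 0)"
    by (intro sum.cong refl) (auto simp: adj_commute)
  also have "\<dots> = W2 u v" unfolding W2_def by (subst sum.inter_restrict) auto
  finally show "walk (\<lambda>u. (if E u v then 1 else 0) / d u) u = W2 u v / d u" by (simp add: walk_def)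
qed

lemma walk3_delta: "v \<in> V \<Longrightarrow> walk (walk (walk (delta v))) = (\<lambda>u. W3 u v / d u)"
  unfolding walk2_delta by (simp add: walk_def W3_def fun_eq_iff)

text \<open>Three of the four eigenvalues annihilate everything but the constants, which gives a polynomial
  identity of degree three in the walk matrix.\<close>

lemma four_eigenvalues_identity:
  assumes "card (walk_eigenvalues V E) = 4"
  shows "\<exists>k s1 s2 s3. k \<noteq> 0 \<and> (\<forall>u\<in>V. \<forall>v\<in>V. W3 u v - s1 * W2 u v + s2 * (if E u v then 1 else 0)
           - s3 * (if u = v then d u else 0) = k * d u * d v)"
proof -
  obtain v0 where v0: "v0 \<in> V" using conn by (auto simp: connected_graph_def)
  have one: "eigenfun 1 (\<lambda>_. 1)"
    unfolding eigenfun_def walk_def using d_pos_V by (force simp: d_eq_card)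
  then have "1 \<in> walk_eigenvalues V E" using v0 unfolding walk_eigenvalues_eq by force
  then have "card (walk_eigenvalues V E - {1}) = 3" using assms by simp
  then obtain a b c where abc: "walk_eigenvalues V E - {1} = {a, b, c}" by (auto simp: card_3_iff)
  then have ev: "walk_eigenvalues V E = {1, a, b, c}" and ne1: "a \<noteq> 1" "b \<noteq> 1" "c \<noteq> 1"
    using \<open>1 \<in> walk_eigenvalues V E\<close> by auto
  define q where "q f = shift a (shift b (shift c f))" for f
  have ipq: "ip (q f) e = (m - a) * (m - b) * (m - c) * ip f e" if "eigenfun m e" for m e f
    unfolding q_def using that by (simp add: ip_shift_eigenfun)
  have q_adj: "ip (q f) g = ip f (q g)" for f g
  proof -
    have comm: "shift x (shift y f) = shift y (shift x f)" for x y f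
      unfolding shift_def walk_lin by (simp add: fun_eq_iff algebra_simps)
    have "q g = shift c (shift b (shift a g))"
      unfolding q_def using comm by metis
    then show ?thesis unfolding q_def by (simp add: shift_self_adjoint)
  qed
  have "\<exists>C. \<forall>u\<in>V. q f u = C" for f
  proof (rule harmonic_const)
    fix u assume "u \<in> V"
    \<comment> \<open>Against an eigenfunction, \<open>shift 1\<close> and \<open>q\<close> together
      produce four factors, one for each eigenvalue, and one of them is 0. Completeness then makes
      \<open>q f\<close> harmonic.\<close>
    have "shift 1 (q f) u = 0"
    proof (rule eigenfun_total[OF _ \<open>u \<in> V\<close>])
      fix m e assume e: "eigenfun m e"
      show "ip (shift 1 (q f)) e = 0"
      proof (cases "\<exists>v\<in>V. e v \<noteq> 0")
        case True
        then have "m \<in> {1, a, b, c}" using e unfolding ev[symmetric] walk_eigenvalues_eq by blast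
        then show ?thesis using e by (auto simp: ip_shift_eigenfun ipq)
      next
        case False
        then show ?thesis by (simp add: ip_def)
      qed
    qed
    then show "walk (q f) u = q f u" by (simp add: shift_def)
  qed
  then have "\<forall>v. \<exists>C. \<forall>u\<in>V. q (delta v) u = C" by blast
  then obtain C where C: "\<And>v u. u \<in> V \<Longrightarrow> q (delta v) u = C v" by (auto dest!: choice)
  \<comment> \<open>Self-adjointness tested on two point masses. It makes the constant
    \<open>C v\<close> of each column proportional to \<open>d v\<close>, the stationary
    distribution up to scale.\<close>
  have sym: "d u * C v = d v * C u" if "u \<in> V" "v \<in> V" for u v
    using q_adj[of "delta v" "delta u"] ip_delta[OF that(1), of "q (delta v)"]
      ip_delta[OF that(2), of "q (delta u)"] C that by (simp add: ip_commute)
  define k where "k = C v0 / d v0"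
  have Ck: "C v = k * d v" if "v \<in> V" for v
    using sym[OF v0 that] d_pos_V[OF v0] by (simp add: k_def field_simps)
  \<comment> \<open>On the constants \<open>q\<close> acts as (1 - a)(1 - b)(1 - c), which is
    nonzero.\<close>
  have "k \<noteq> 0"
  proof
    assume "k = 0"
    then have "ip (q (delta v0)) (\<lambda>_. 1) = 0" using C Ck[OF v0] by (simp add: ip_def)
    moreover have "ip (delta v0) (\<lambda>_. 1) = d v0" using ip_delta[OF v0, of "\<lambda>_. 1"] by (simp add: ip_commute)
    ultimately show False using ipq[OF one, of "delta v0"] ne1 d_pos_V[OF v0] by simp
  qed
  \<comment> \<open>The coefficients are the elementary symmetric functions of \<open>a\<close>,
    \<open>b\<close>, \<open>c\<close>; the entry of \<open>q\<close> is multiplied by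
    \<open>d u\<close> to make it symmetric.\<close>
  moreover have "W3 u v - (a + b + c) * W2 u v + (a * b + b * c + c * a) * (if E u v then 1 else 0)
           - (a * b * c) * (if u = v then d u else 0) = k * d u * d v" if "u \<in> V" "v \<in> V" for u v
  proof -
    have "q f x = walk (walk (walk f)) x - (a + b + c) * walk (walk f) x
        + (a * b + b * c + c * a) * walk f x - a * b * c * f x" for f x
      unfolding q_def shift_def walk_lin by (simp add: algebra_simps)
    then have "k * d v = W3 u v / d u - (a + b + c) * (W2 u v / d u)
        + (a * b + b * c + c * a) * ((if E u v then 1 else 0) / d u) - a * b * c * delta v u"
      using C[OF that(1), of v] Ck[OF that(2)] fun_cong[OF walk_delta[OF that(2)], of u]
        fun_cong[OF walk2_delta[OF that(2)], of u] fun_cong[OF walk3_delta[OF that(2)], of u] by simp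
    then have "k * d v * d u = (W3 u v / d u - (a + b + c) * (W2 u v / d u)
        + (a * b + b * c + c * a) * ((if E u v then 1 else 0) / d u) - a * b * c * delta v u) * d u" by simp
    also have "\<dots> = W3 u v - (a + b + c) * W2 u v + (a * b + b * c + c * a) * (if E u v then 1 else 0)
           - (a * b * c) * (if u = v then d u else 0)"
      using d_pos_V[OF that(1)] by (simp add: delta_def field_simps)
    finally show ?thesis by (simp add: algebra_simps)
  qed
  ultimately show ?thesis by blast
qed

end

section \<open>Eigenvalues of the small graphs\<close>

lemma card_le_degree_if_poly_roots:
  fixes p :: "real poly"
  assumes "p \<noteq> 0" "\<And>x. x \<in> S \<Longrightarrow> poly p x = 0"
  shows "finite S" "card S \<le> Polynomial.degree p"
proof -
  have *: "S \<subseteq> {x. poly p x = 0}" using assms(2) by blast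
  show "finite S" using finite_subset[OF * poly_roots_finite[OF assms(1)]] .
  show "card S \<le> Polynomial.degree p"
    using card_mono[OF poly_roots_finite[OF assms(1)] *] card_poly_roots_bound[OF assms(1)] by linarith
qed

text \<open>The predecessor is written \<open>u + n - 1\<close> to keep natural subtraction from
  truncating at 0. From three vertices on, the two neighbours differ.\<close>

lemma cycle_neighbours:
  assumes "3 \<le> n" "u < n"
  shows "{v \<in> cycle_V n. cycle_E n u v} = {(u + 1) mod n, (u + n - 1) mod n}"
    and "(u + 1) mod n \<noteq> (u + n - 1) mod n"
proof -
  have a: "(u + 1) mod n = (if u = n - 1 then 0 else u + 1)"
    using assms by auto
  have b: "(u + n - 1) mod n = (if u = 0 then n - 1 else u - 1)"
    using assms by (auto simp: mod_if)
  have c: "u = (v + 1) mod n \<longleftrightarrow> v = (u + n - 1) mod n" if "v < n" for v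
    using assms that unfolding b by (auto simp: mod_if)
  show "(u + 1) mod n \<noteq> (u + n - 1) mod n" unfolding a b using assms by auto
  have "cycle_E n u v \<longleftrightarrow> v = (u + 1) mod n \<or> v = (u + n - 1) mod n" if "v < n" for v
    unfolding cycle_E_def c[OF that] a b using assms that by auto
  then show "{v \<in> cycle_V n. cycle_E n u v} = {(u + 1) mod n, (u + n - 1) mod n}"
    using assms by (auto simp: cycle_V_def)
qed

lemma walk_eigenvalues_cycle:
  assumes n: "3 \<le> n"
  shows "walk_eigenvalues (cycle_V n) (cycle_E n) = {c. \<exists>g. (\<exists>v<n. g v \<noteq> 0) \<and>
           (\<forall>u<n. g ((u + 1) mod n) + g ((u + n - 1) mod n) = 2 * c * g u)}"
proof -
  have "degree (cycle_V n) (cycle_E n) u = 2" if "u < n" for u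
    unfolding degree_def cycle_neighbours(1)[OF n that] using cycle_neighbours(2)[OF n that] by simp
  moreover have "(\<Sum>v\<in>{v\<in>cycle_V n. cycle_E n u v}. g v) = g ((u + 1) mod n) + g ((u + n - 1) mod n)"
    if "u < n" for u and g :: "nat \<Rightarrow> real"
    unfolding cycle_neighbours(1)[OF n that] using cycle_neighbours(2)[OF n that] by simp
  ultimately show ?thesis
    by (simp add: walk_eigenvalues_def cycle_V_def Bex_def Ball_def mult.commute cong: conj_cong)
qed

text \<open>The eigenfunction is cos (a j) with a = 2 pi k / n: the addition formulas give cos (x +
  a) + cos (x - a) = 2 cos a cos x, and reduction modulo n changes the angle by a multiple of 2
  pi.\<close>

lemma cos_in_walk_eigenvalues_cycle:
  assumes n: "3 \<le> n"
  shows "cos (2 * pi * real k / real n) \<in> walk_eigenvalues (cycle_V n) (cycle_E n)"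
proof -
  define a where "a = 2 * pi * real k / real n"
  have an: "a * real n = 2 * pi * real k" using n by (simp add: a_def)
  have per: "cos (a * real (j mod n)) = cos (a * real j)" for j
  proof -
    have "a * real j = a * real (j mod n) + a * real n * real (j div n)"
      by (metis (no_types) add.commute distrib_left mult.assoc mult_div_mod_eq of_nat_add of_nat_mult)
    also have "\<dots> = a * real (j mod n) + 2 * real (k * (j div n)) * pi" unfolding an by simp
    finally show ?thesis by (simp only: cos_add cos_2npi sin_2npi)
  qed
  have "cos (a * real ((u + 1) mod n)) + cos (a * real ((u + n - 1) mod n)) = 2 * cos a * cos (a * real u)"
    if "u < n" for u
  proof -
    have "a * real (u + n - 1) = (a * real u - a) + 2 * real k * pi"
      using n an by (simp add: of_nat_diff algebra_simps)
    then have "cos (a * real (u + n - 1)) = cos (a * real u - a)" by (simp only: cos_add cos_2npi sin_2npi)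
    moreover have "cos (a * real (u + 1)) = cos (a * real u + a)" by (simp add: algebra_simps)
    ultimately show ?thesis unfolding per by (simp add: cos_add cos_diff)
  qed
  moreover have "cos (a * real 0) \<noteq> 0" by simp
  moreover have "0 < n" using n by simp
  ultimately show ?thesis unfolding walk_eigenvalues_cycle[OF n] a_def[symmetric]
    by (intro CollectI exI[of _ "\<lambda>j. cos (a * real j)"]) blast
qed

text \<open>For k up to n/2 the angles 2 pi k / n lie in [0, pi], where cosine is injective. This
  bounds n when there are four eigenvalues and supplies the lower bound for n = 6, 7.\<close>

lemma card_walk_eigenvalues_cycle_ge:
  assumes n: "3 \<le> n" and fin: "finite (walk_eigenvalues (cycle_V n) (cycle_E n))"
  shows "n div 2 + 1 \<le> card (walk_eigenvalues (cycle_V n) (cycle_E n))"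
proof -
  let ?f = "\<lambda>k. cos (2 * pi * real k / real n)"
  have "inj_on ?f {..n div 2}"
  proof (rule inj_onI)
    fix i j assume ij: "i \<in> {..n div 2}" "j \<in> {..n div 2}" and eq: "?f i = ?f j"
    have le: "2 * pi * real i / real n \<le> pi" if "i \<in> {..n div 2}" for i
    proof -
      have "2 * i \<le> n" using that by auto
      then have "2 * real i \<le> real n" by linarith
      then show ?thesis using n by (simp add: field_simps)
    qed
    have "2 * pi * real i / real n = 2 * pi * real j / real n"
      by (rule cos_inj_pi[OF _ le[OF ij(1)] _ le[OF ij(2)] eq]) simp_all
    then show "i = j" using n by simp
  qed
  then have "card (?f ` {..n div 2}) = n div 2 + 1" by (simp add: card_image)
  moreover have "?f ` {..n div 2} \<subseteq> walk_eigenvalues (cycle_V n) (cycle_E n)"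
    using cos_in_walk_eigenvalues_cycle[OF n] by blast
  ultimately show ?thesis using card_mono[OF fin] by metis
qed

text \<open>The coefficients are twice the Chebyshev polynomials of c; the period n closes this recursion to
  a polynomial equation for c.\<close>

lemma cycle_eigenvalue_recursion:
  assumes n: "3 \<le> n" and c: "c \<in> walk_eigenvalues (cycle_V n) (cycle_E n)"
  obtains h :: "nat \<Rightarrow> real" and j where "h (j + 4) \<noteq> 0" "\<And>i. h (i + n) = h i"
    "\<And>i. h (i + 2) + h i = 2 * c * h (i + 1)"
    "\<And>i. h (i + 4) + h i = (4 * c\<^sup>2 - 2) * h (i + 2)"
    "\<And>i. h (i + 6) + h i = (8 * c ^ 3 - 6 * c) * h (i + 3)"
    "\<And>i. h (i + 8) + h i = (16 * c ^ 4 - 16 * c\<^sup>2 + 2) * h (i + 4)"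
proof -
  obtain g v where v: "v < n" "g v \<noteq> 0"
    and g: "\<And>u. u < n \<Longrightarrow> g ((u + 1) mod n) + g ((u + n - 1) mod n) = 2 * c * g u"
    using c unfolding walk_eigenvalues_cycle[OF n] by blast
  define h where "h j = g (j mod n)" for j
  have per: "h (i + n) = h i" for i by (simp add: h_def)
  have r1: "h (i + 2) + h i = 2 * c * h (i + 1)" for i
  proof -
    have "((i + 1) mod n + 1) mod n = (i + 2) mod n"
      by (simp add: mod_simps)
    moreover have "((i + 1) mod n + n - 1) mod n = ((i + 1) mod n + (n - 1)) mod n" using n by simp
    then have "((i + 1) mod n + n - 1) mod n = (i + 1 + (n - 1)) mod n" by (simp only: mod_add_left_eq)
    then have "((i + 1) mod n + n - 1) mod n = i mod n" using n by simp
    ultimately show ?thesis using g[of "(i + 1) mod n"] n by (simp add: h_def)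
  qed
  have r2: "h (i + 4) + h i = (4 * c\<^sup>2 - 2) * h (i + 2)" for i
  proof -
    have "h (i + 4) = 2 * c * h (i + 3) - h (i + 2)" "h (i + 3) = 2 * c * h (i + 2) - h (i + 1)"
      "h (i + 2) + h i = 2 * c * h (i + 1)"
      using r1[of "i + 2"] r1[of "i + 1"] r1[of i] by (simp_all add: eval_nat_numeral algebra_simps)
    then show ?thesis by algebra
  qed
  have r3: "h (i + 6) + h i = (8 * c ^ 3 - 6 * c) * h (i + 3)" for i
  proof -
    have "h (i + 6) + h (i + 2) = (4 * c\<^sup>2 - 2) * h (i + 4)" "h (i + 4) + h i = (4 * c\<^sup>2 - 2) * h (i + 2)"
      "h (i + 4) + h (i + 2) = 2 * c * h (i + 3)"
      using r2[of "i + 2"] r2[of i] r1[of "i + 2"] by (simp_all add: eval_nat_numeral algebra_simps)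
    then show ?thesis by algebra
  qed
  have r4: "h (i + 8) + h i = (16 * c ^ 4 - 16 * c\<^sup>2 + 2) * h (i + 4)" for i
  proof -
    have "h (i + 8) + h (i + 4) = (4 * c\<^sup>2 - 2) * h (i + 6)" "h (i + 4) + h i = (4 * c\<^sup>2 - 2) * h (i + 2)"
      "h (i + 6) + h (i + 2) = (4 * c\<^sup>2 - 2) * h (i + 4)"
      using r2[of "i + 4"] r2[of i] r2[of "i + 2"] by (simp_all add: eval_nat_numeral algebra_simps)
    then show ?thesis by algebra
  qed
  \<comment> \<open>The nonzero value is moved up by four periods, so that its index is at least 4
    and the recursions can be centred there without leaving the natural numbers.\<close>
  have "h (v + n * 4) = h v" by (simp add: h_def)
  moreover have "v + n * 4 = (v + n * 4 - 4) + 4" using n by simp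
  ultimately have "h ((v + n * 4 - 4) + 4) \<noteq> 0" using v by (simp add: h_def)
  with per r1 r2 r3 r4 show ?thesis using that by blast
qed

lemma card_walk_eigenvalues_small_cycle:
  assumes "n \<in> {3, 4, 5}"
  shows "card (walk_eigenvalues (cycle_V n) (cycle_E n)) \<le> 3"
proof -
  \<comment> \<open>With T_i the Chebyshev polynomials these are 2(T_2 - T_1), 2(T_3 - T_1) and
    2(T_3 - T_2). Modulo n the index pairs at distance 2 and 1, 3 and 1, 3 and 2 from the centre
    coincide, which equates the two sums.\<close>
  define p :: "real poly" where
    "p = (if n = 3 then [:-2, -2, 4:] else if n = 4 then [:0, -8, 0, 8:] else [:2, -6, -4, 8:])"
  have "poly p c = 0" if c: "c \<in> walk_eigenvalues (cycle_V n) (cycle_E n)" for c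
  proof -
    have "3 \<le> n" using assms by auto
    then obtain h :: "nat \<Rightarrow> real" and j where h: "h (j + 4) \<noteq> 0" "\<And>i. h (i + n) = h i"
      "\<And>i. h (i + 2) + h i = 2 * c * h (i + 1)"
      "\<And>i. h (i + 4) + h i = (4 * c\<^sup>2 - 2) * h (i + 2)"
      "\<And>i. h (i + 6) + h i = (8 * c ^ 3 - 6 * c) * h (i + 3)"
      using cycle_eigenvalue_recursion[OF _ c] by metis
    have "poly p c * h (j + 4) = 0"
    proof -
      consider "n = 3" | "n = 4" | "n = 5" using assms by auto
      then show ?thesis
      proof cases
        case 1
        have "h (j + 6) + h (j + 2) = (4 * c\<^sup>2 - 2) * h (j + 4)" using h(4)[of "j + 2"] by (simp add: eval_nat_numeral)
        moreover have "h (j + 5) + h (j + 3) = 2 * c * h (j + 4)" using h(3)[of "j + 3"] by (simp add: eval_nat_numeral)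
        moreover have "h (j + 6) = h (j + 3)" using h(2)[of "j + 3"] 1 by (simp add: eval_nat_numeral)
        moreover have "h (j + 5) = h (j + 2)" using h(2)[of "j + 2"] 1 by (simp add: eval_nat_numeral)
        moreover have "poly p c = 4 * c\<^sup>2 - 2 - 2 * c" using 1 by (simp add: p_def algebra_simps power2_eq_square)
        ultimately show ?thesis by (simp add: left_diff_distrib)
      next
        case 2
        have "h (j + 7) + h (j + 1) = (8 * c ^ 3 - 6 * c) * h (j + 4)" using h(5)[of "j + 1"] by (simp add: eval_nat_numeral)
        moreover have "h (j + 5) + h (j + 3) = 2 * c * h (j + 4)" using h(3)[of "j + 3"] by (simp add: eval_nat_numeral)
        moreover have "h (j + 7) = h (j + 3)" using h(2)[of "j + 3"] 2 by (simp add: eval_nat_numeral)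
        moreover have "h (j + 5) = h (j + 1)" using h(2)[of "j + 1"] 2 by (simp add: eval_nat_numeral)
        moreover have "poly p c = (8 * c ^ 3 - 6 * c) - 2 * c" using 2 by (simp add: p_def algebra_simps power3_eq_cube)
        ultimately show ?thesis by (simp only: left_diff_distrib)
      next
        case 3
        have "h (j + 7) + h (j + 1) = (8 * c ^ 3 - 6 * c) * h (j + 4)" using h(5)[of "j + 1"] by (simp add: eval_nat_numeral)
        moreover have "h (j + 6) + h (j + 2) = (4 * c\<^sup>2 - 2) * h (j + 4)" using h(4)[of "j + 2"] by (simp add: eval_nat_numeral)
        moreover have "h (j + 7) = h (j + 2)" using h(2)[of "j + 2"] 3 by (simp add: eval_nat_numeral)
        moreover have "h (j + 6) = h (j + 1)" using h(2)[of "j + 1"] 3 by (simp add: eval_nat_numeral)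
        moreover have "poly p c = (8 * c ^ 3 - 6 * c) - (4 * c\<^sup>2 - 2)"
          using 3 by (simp add: p_def algebra_simps power3_eq_cube power2_eq_square)
        ultimately show ?thesis by (simp only: left_diff_distrib)
      qed
    qed
    then show ?thesis using h(1) by simp
  qed
  moreover have "p \<noteq> 0" "Polynomial.degree p \<le> 3" by (auto simp: p_def)
  ultimately show ?thesis using card_le_degree_if_poly_roots(2) by (meson le_trans)
qed

text \<open>Distances 4 and 2 from the centre coincide modulo 6, distances 4 and 3 modulo 7. The
  resulting quartics 2(T_4 - T_2) and 2(T_4 - T_3) bound the number of eigenvalues by 4, and the
  cosines attain it.\<close>

lemma card_walk_eigenvalues_cycle_6_7:
  assumes "n \<in> {6, 7}"
  shows "card (walk_eigenvalues (cycle_V n) (cycle_E n)) = 4"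
proof -
  define p :: "real poly" where
    "p = (if n = 6 then [:4, 0, -20, 0, 16:] else [:2, 6, -16, -8, 16:])"
  have n: "3 \<le> n" using assms by auto
  have root: "poly p c = 0" if c: "c \<in> walk_eigenvalues (cycle_V n) (cycle_E n)" for c
  proof -
    obtain h :: "nat \<Rightarrow> real" and j where h: "h (j + 4) \<noteq> 0" "\<And>i. h (i + n) = h i"
      "\<And>i. h (i + 4) + h i = (4 * c\<^sup>2 - 2) * h (i + 2)"
      "\<And>i. h (i + 6) + h i = (8 * c ^ 3 - 6 * c) * h (i + 3)"
      "\<And>i. h (i + 8) + h i = (16 * c ^ 4 - 16 * c\<^sup>2 + 2) * h (i + 4)"
      using cycle_eigenvalue_recursion[OF n c] by metis
    have "poly p c * h (j + 4) = 0"
    proof -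
      consider "n = 6" | "n = 7" using assms by auto
      then show ?thesis
      proof cases
        case 1
        have "h (j + 8) + h j = (16 * c ^ 4 - 16 * c\<^sup>2 + 2) * h (j + 4)" using h(5)[of j] by (simp add: eval_nat_numeral)
        moreover have "h (j + 6) + h (j + 2) = (4 * c\<^sup>2 - 2) * h (j + 4)" using h(3)[of "j + 2"] by (simp add: eval_nat_numeral)
        moreover have "h (j + 8) = h (j + 2)" using h(2)[of "j + 2"] 1 by (simp add: eval_nat_numeral)
        moreover have "h (j + 6) = h j" using h(2)[of j] 1 by (simp add: eval_nat_numeral)
        moreover have "poly p c = (16 * c ^ 4 - 16 * c\<^sup>2 + 2) - (4 * c\<^sup>2 - 2)"
          using 1 by (simp add: p_def algebra_simps power4_eq_xxxx power2_eq_square)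
        ultimately show ?thesis by (simp only: left_diff_distrib)
      next
        case 2
        have "h (j + 8) + h j = (16 * c ^ 4 - 16 * c\<^sup>2 + 2) * h (j + 4)" using h(5)[of j] by (simp add: eval_nat_numeral)
        moreover have "h (j + 7) + h (j + 1) = (8 * c ^ 3 - 6 * c) * h (j + 4)" using h(4)[of "j + 1"] by (simp add: eval_nat_numeral)
        moreover have "h (j + 8) = h (j + 1)" using h(2)[of "j + 1"] 2 by (simp add: eval_nat_numeral)
        moreover have "h (j + 7) = h j" using h(2)[of j] 2 by (simp add: eval_nat_numeral)
        moreover have "poly p c = (16 * c ^ 4 - 16 * c\<^sup>2 + 2) - (8 * c ^ 3 - 6 * c)"
          using 2 by (simp add: p_def algebra_simps power4_eq_xxxx power2_eq_square power3_eq_cube)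
        ultimately show ?thesis by (simp only: left_diff_distrib)
      qed
    qed
    then show ?thesis using h(1) by simp
  qed
  have p: "p \<noteq> 0" "Polynomial.degree p \<le> 4" by (auto simp: p_def)
  have "n div 2 + 1 = 4" using assms by auto
  then show ?thesis
    using card_le_degree_if_poly_roots[OF p(1) root] p(2) card_walk_eigenvalues_cycle_ge[OF n] by fastforce
qed

section \<open>Spectra of the two triangle graphs, as equations in the values at the
  vertices\<close>

lemma walk_eigenvalues_U21:
  "walk_eigenvalues U21_V U21_E = {c. \<exists>g0 g1 g2 g3. (g0 \<noteq> 0 \<or> g1 \<noteq> 0 \<or> g2 \<noteq> 0 \<or> g3 \<noteq> 0) \<and>
     g1 + g2 + g3 = c * 3 * g0 \<and> g0 + g2 = c * 2 * g1 \<and> g0 + g1 = c * 2 * g2 \<and> g0 = c * g3}"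
    (is "_ = {c. \<exists>g0 g1 g2 g3. ?P c g0 g1 g2 g3}")
proof -
  have nb: "{v \<in> U21_V. U21_E 0 v} = {1, 2, 3}" "{v \<in> U21_V. U21_E 1 v} = {0, 2}"
    "{v \<in> U21_V. U21_E 2 v} = {0, 1}" "{v \<in> U21_V. U21_E 3 v} = {0}"
    by (auto simp: U21_V_def U21_E_def doubleton_eq_iff)
  have eq: "(\<exists>v\<in>U21_V. g v \<noteq> 0) \<and> (\<forall>u\<in>U21_V. (\<Sum>v\<in>{v\<in>U21_V. U21_E u v}. g v) = c * real (degree U21_V U21_E u) * g u)
     \<longleftrightarrow> ?P c (g 0) (g 1) (g 2) (g 3)" for g c
    unfolding degree_def by (subst (1 2) U21_V_def) (simp only: ball_simps bex_simps nb, simp add: algebra_simps)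
  have "(\<exists>g :: nat \<Rightarrow> real. ?P c (g 0) (g 1) (g 2) (g 3)) \<longleftrightarrow> (\<exists>g0 g1 g2 g3. ?P c g0 g1 g2 g3)" (is "?L \<longleftrightarrow> ?R") for c
  proof
    assume ?R
    then obtain g0 g1 g2 g3 where P: "?P c g0 g1 g2 g3" by blast
    define g where "g i = [g0, g1, g2, g3] ! i" for i
    have "g 0 = g0" "g 1 = g1" "g 2 = g2" "g 3 = g3" by (simp_all add: g_def eval_nat_numeral)
    with P have "?P c (g 0) (g 1) (g 2) (g 3)" by metis
    then show ?L by blast
  qed blast
  then show ?thesis unfolding walk_eigenvalues_def eq by simp
qed

lemma card_walk_eigenvalues_U21: "card (walk_eigenvalues U21_V U21_E) = 4"
proof -
  \<comment> \<open>Chosen so that \<open>- 1 / 4 + s / 2\<close> and \<open>- 1 / 4 - s / 2\<close>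
    are the roots of 12 c^2 + 6 c - 2.\<close>
  define s :: real where "s = sqrt (11 / 12)"
  have ss: "s * s = 11 / 12" by (simp add: s_def)
  have s0: "s > 0" by (simp add: s_def)
  have s1: "s < 1" by (simp add: s_def)
  have "walk_eigenvalues U21_V U21_E = {1, - 1 / 2, - 1 / 4 + s / 2, - 1 / 4 - s / 2}"
  proof (intro equalityI subsetI)
    fix c assume "c \<in> walk_eigenvalues U21_V U21_E"
    then obtain g0 g1 g2 g3 :: real where nz: "g0 \<noteq> 0 \<or> g1 \<noteq> 0 \<or> g2 \<noteq> 0 \<or> g3 \<noteq> 0"
      and e: "g1 + g2 + g3 = c * 3 * g0" "g0 + g2 = c * 2 * g1" "g0 + g1 = c * 2 * g2" "g0 = c * g3"
      unfolding walk_eigenvalues_U21 by blast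
    \<comment> \<open>Subtracting the equations at the two vertices exchanged by the reflection
      separates the antisymmetric eigenfunction, with value -1/2, from the symmetric ones.\<close>
    have "(2 * c + 1) * (g1 - g2) = 0" using e by algebra
    then consider "2 * c + 1 = 0" | "g1 = g2" by auto
    then show "c \<in> {1, - 1 / 2, - 1 / 4 + s / 2, - 1 / 4 - s / 2}"
    proof cases
      case 2
      have g0: "g0 = (2 * c - 1) * g1" using e 2 by algebra
      have "(c - 1) * (12 * c * c + 6 * c - 2) * g1 = 0" "(c - 1) * (12 * c * c + 6 * c - 2) * g3 = 0"
        using e 2 by algebra+
      moreover have "g1 \<noteq> 0 \<or> g3 \<noteq> 0" using nz 2 g0 by auto
      ultimately have "(c - 1) * (12 * c * c + 6 * c - 2) = 0" by auto
      moreover have "12 * c * c + 6 * c - 2 = 12 * (c - (- 1 / 4 + s / 2)) * (c - (- 1 / 4 - s / 2))"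
        using ss by (simp add: field_simps)
      ultimately show ?thesis by auto
    qed auto
  next
    fix c assume "c \<in> {1, - 1 / 2, - 1 / 4 + s / 2, - 1 / 4 - s / 2}"
    then consider "c = 1" | "c = - 1 / 2" | "c = - 1 / 4 + s / 2 \<or> c = - 1 / 4 - s / 2" by auto
    then show "c \<in> walk_eigenvalues U21_V U21_E"
    proof cases
      case 1
      then show ?thesis unfolding walk_eigenvalues_U21
        by - (rule CollectI, rule exI[of _ 1], rule exI[of _ 1], rule exI[of _ 1], rule exI[of _ 1], auto)
    next
      case 2
      then show ?thesis unfolding walk_eigenvalues_U21
        by - (rule CollectI, rule exI[of _ 0], rule exI[of _ 1], rule exI[of _ "- 1"], rule exI[of _ 0], auto)
    next
      case 3
      then have "4 * c + 1 = 2 * s \<or> 4 * c + 1 = - 2 * s" by auto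
      then have "(4 * c + 1) * (4 * c + 1) = 4 * (s * s)" by auto
      then have q: "12 * c * c + 6 * c - 2 = 0" unfolding ss by (simp add: algebra_simps)
      \<comment> \<open>The symmetric solution scaled to \<open>g1 = g2 = c\<close>: the triangle
        gives \<open>g0 = (2 * c - 1) * g1\<close>, and then \<open>g0 = c * g3\<close> gives
        \<open>g3 = 2 * c - 1\<close>.\<close>
      have "c + c + (2 * c - 1) = c * 3 * (c * (2 * c - 1))" using q by algebra
      moreover have "c * (2 * c - 1) + c = c * 2 * c" by algebra
      moreover have "c \<noteq> 0" using q by auto
      ultimately show ?thesis unfolding walk_eigenvalues_U21
        by - (rule CollectI, rule exI[of _ "c * (2 * c - 1)"], rule exI[of _ c], rule exI[of _ c], rule exI[of _ "2 * c - 1"], auto)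
    qed
  qed
  moreover have "- 1 / 4 + s / 2 \<noteq> 1" "- 1 / 4 + s / 2 \<noteq> - 1 / 2" "- 1 / 4 - s / 2 \<noteq> 1"
    "- 1 / 4 + s / 2 \<noteq> - 1 / 4 - s / 2" using s0 s1 by linarith+
  \<comment> \<open>The bounds 0 < s < 1 do not exclude s = 1/2; the square does.\<close>
  moreover have "- 1 / 4 - s / 2 \<noteq> - 1 / 2"
  proof
    assume "- 1 / 4 - s / 2 = - 1 / 2"
    then have "s = 1 / 2" by simp
    then have "s * s = 1 / 4" by (simp only:)
    then show False using ss by simp
  qed
  ultimately show ?thesis by (simp del: div_minus1_right)
qed

lemma walk_eigenvalues_U4111:
  "walk_eigenvalues U4111_V U4111_E = {c. \<exists>g0 g1 g2 g3 g4 g5.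
     (g0 \<noteq> 0 \<or> g1 \<noteq> 0 \<or> g2 \<noteq> 0 \<or> g3 \<noteq> 0 \<or> g4 \<noteq> 0 \<or> g5 \<noteq> 0) \<and>
     g1 + g2 + g3 = c * 3 * g0 \<and> g0 + g2 + g4 = c * 3 * g1 \<and> g0 + g1 + g5 = c * 3 * g2 \<and>
     g0 = c * g3 \<and> g1 = c * g4 \<and> g2 = c * g5}"
    (is "_ = {c. \<exists>g0 g1 g2 g3 g4 g5. ?P c g0 g1 g2 g3 g4 g5}")
proof -
  have nb: "{v \<in> U4111_V. U4111_E 0 v} = {1, 2, 3}" "{v \<in> U4111_V. U4111_E 1 v} = {0, 2, 4}"
    "{v \<in> U4111_V. U4111_E 2 v} = {0, 1, 5}" "{v \<in> U4111_V. U4111_E 3 v} = {0}"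
    "{v \<in> U4111_V. U4111_E 4 v} = {1}" "{v \<in> U4111_V. U4111_E 5 v} = {2}"
    by (auto simp: U4111_V_def U4111_E_def doubleton_eq_iff)
  have eq: "(\<exists>v\<in>U4111_V. g v \<noteq> 0) \<and> (\<forall>u\<in>U4111_V. (\<Sum>v\<in>{v\<in>U4111_V. U4111_E u v}. g v) = c * real (degree U4111_V U4111_E u) * g u)
     \<longleftrightarrow> ?P c (g 0) (g 1) (g 2) (g 3) (g 4) (g 5)" for g c
    unfolding degree_def by (subst (1 2) U4111_V_def) (simp only: ball_simps bex_simps nb, simp add: algebra_simps)
  have "(\<exists>g :: nat \<Rightarrow> real. ?P c (g 0) (g 1) (g 2) (g 3) (g 4) (g 5)) \<longleftrightarrow> (\<exists>g0 g1 g2 g3 g4 g5. ?P c g0 g1 g2 g3 g4 g5)"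
    (is "?L \<longleftrightarrow> ?R") for c
  proof
    assume ?R
    then obtain g0 g1 g2 g3 g4 g5 where P: "?P c g0 g1 g2 g3 g4 g5" by blast
    define g where "g i = [g0, g1, g2, g3, g4, g5] ! i" for i
    have "g 0 = g0" "g 1 = g1" "g 2 = g2" "g 3 = g3" "g 4 = g4" "g 5 = g5"
      by (simp_all add: g_def eval_nat_numeral)
    with P have "?P c (g 0) (g 1) (g 2) (g 3) (g 4) (g 5)" by metis
    then show ?L by blast
  qed blast
  then show ?thesis unfolding walk_eigenvalues_def eq by simp
qed

lemma card_walk_eigenvalues_U4111: "card (walk_eigenvalues U4111_V U4111_E) = 4"
proof -
  define s :: real where "s = sqrt 13"
  have ss: "s * s = 13" by (simp add: s_def)
  have s3: "s > 3" using real_less_rsqrt[of 3 13] by (simp add: s_def)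
  have s4: "s < 4" using real_less_lsqrt[of 4 13] by (simp add: s_def)
  have "walk_eigenvalues U4111_V U4111_E = {1, - 1 / 3, - 1 / 6 + s / 6, - 1 / 6 - s / 6}"
  proof (intro equalityI subsetI)
    fix c assume "c \<in> walk_eigenvalues U4111_V U4111_E"
    then obtain g0 g1 g2 g3 g4 g5 :: real where nz: "g0 \<noteq> 0 \<or> g1 \<noteq> 0 \<or> g2 \<noteq> 0 \<or> g3 \<noteq> 0 \<or> g4 \<noteq> 0 \<or> g5 \<noteq> 0"
      and e: "g1 + g2 + g3 = c * 3 * g0" "g0 + g2 + g4 = c * 3 * g1" "g0 + g1 + g5 = c * 3 * g2"
        "g0 = c * g3" "g1 = c * g4" "g2 = c * g5"
      unfolding walk_eigenvalues_U4111 by blast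
    \<comment> \<open>The sum over the leaves is the rotation-invariant part. If it is nonzero, the
      quadratic with roots 1 and -1/3 vanishes; if it is zero, any nonzero leaf value yields the
      other quadratic.\<close>
    define t where "t = g3 + g4 + g5"
    have "(3 * c * c - 2 * c - 1) * t = 0" unfolding t_def using e by algebra
    moreover have "(3 * c * c + c - 1) * g3 = c * t" "(3 * c * c + c - 1) * g4 = c * t" "(3 * c * c + c - 1) * g5 = c * t"
      unfolding t_def using e by algebra+
    moreover have "g3 \<noteq> 0 \<or> g4 \<noteq> 0 \<or> g5 \<noteq> 0" using nz e by auto
    ultimately have "3 * c * c - 2 * c - 1 = 0 \<or> 3 * c * c + c - 1 = 0" by auto
    moreover have "3 * c * c + c - 1 = 3 * (c - (- 1 / 6 + s / 6)) * (c - (- 1 / 6 - s / 6))"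
      using ss by (simp add: field_simps)
    moreover have "3 * c * c - 2 * c - 1 = 3 * (c - 1) * (c - (- 1 / 3))" by (simp add: field_simps)
    ultimately show "c \<in> {1, - 1 / 3, - 1 / 6 + s / 6, - 1 / 6 - s / 6}" by auto
  next
    fix c assume "c \<in> {1, - 1 / 3, - 1 / 6 + s / 6, - 1 / 6 - s / 6}"
    then consider "c = 1" | "c = - 1 / 3" | "c = - 1 / 6 + s / 6 \<or> c = - 1 / 6 - s / 6" by auto
    then show "c \<in> walk_eigenvalues U4111_V U4111_E"
    proof cases
      case 1
      then show ?thesis unfolding walk_eigenvalues_U4111 by - (rule CollectI, rule exI[of _ 1], rule exI[of _ 1], rule exI[of _ 1], rule exI[of _ 1], rule exI[of _ 1], rule exI[of _ 1], auto)
    next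
      case 2
      then show ?thesis unfolding walk_eigenvalues_U4111
        by - (rule CollectI, rule exI[of _ "- 1"], rule exI[of _ "- 1"], rule exI[of _ "- 1"], rule exI[of _ 3], rule exI[of _ 3], rule exI[of _ 3], auto)
    next
      case 3
      then have "6 * c + 1 = s \<or> 6 * c + 1 = - s" by auto
      then have "(6 * c + 1) * (6 * c + 1) = s * s" by auto
      then have "3 * c * c + c - 1 = 0" unfolding ss by (simp add: algebra_simps)
      then have "- c + 1 = c * 3 * c" by algebra
      \<comment> \<open>An eigenfunction of leaf sum 0: leaf values 1, -1, 0, and \<open>c\<close>
        times these on the triangle.\<close>
      then show ?thesis unfolding walk_eigenvalues_U4111
        by - (rule CollectI, rule exI[of _ c], rule exI[of _ "- c"], rule exI[of _ 0], rule exI[of _ 1], rule exI[of _ "- 1"], rule exI[of _ 0], auto)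
    qed
  qed
  moreover have "- 1 / 6 + s / 6 \<noteq> 1" "- 1 / 6 + s / 6 \<noteq> - 1 / 3" "- 1 / 6 - s / 6 \<noteq> 1"
    "- 1 / 6 + s / 6 \<noteq> - 1 / 6 - s / 6" "- 1 / 6 - s / 6 \<noteq> - 1 / 3" using s3 s4 by linarith+
  ultimately show ?thesis by (simp del: div_minus1_right)
qed

section \<open>Graphs without pendant vertices\<close>

text \<open>Double counting of ordered adjacent pairs: each edge is the image of exactly
  two.\<close>

lemma (in fin_graph) handshake: "(\<Sum>u\<in>V. degree V E u) = 2 * card (edge_set E)"
proof -
  define A where "A = (SIGMA u:V. nb u)"
  define f where "f a = {fst a, snd a}" for a :: "'a \<times> 'a"
  have finA: "finite A" using fin by (simp add: A_def)
  have im: "f ` A = edge_set E"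
    using adj_V by (fastforce simp: f_def A_def edge_set_def image_iff)
  have fibre: "card {a \<in> A. f a = e} = 2" if e: "e \<in> edge_set E" for e
  proof -
    obtain u v where uv: "e = {u, v}" "E u v" using e by (auto simp: edge_set_def)
    then have "{a \<in> A. f a = e} = {(u, v), (v, u)}"
      using adj_V adj_sym by (auto simp: A_def f_def doubleton_eq_iff)
    moreover have "u \<noteq> v" using uv(2) by auto
    ultimately show ?thesis by simp
  qed
  have "card A = (\<Sum>u\<in>V. degree V E u)"
    unfolding A_def using fin by (simp add: degree_def nb_def)
  moreover have "card A = (\<Sum>e\<in>f ` A. card {a \<in> A. f a = e})"
    using sum.group[OF finA finite_imageI[OF finA, of f] subset_refl, where h = "\<lambda>_. 1 :: nat"] by simp
  ultimately show ?thesis using im fibre by simp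
qed

context conn_graph
begin

text \<open>A walk that never turns back is determined by its first step. Its first repeated vertex
  must be its starting vertex, and the closed walk exhausts \<open>V\<close> by
  connectedness.\<close>

lemma two_regular_iso_cycle:
  assumes reg: "\<And>u. u \<in> V \<Longrightarrow> card (nb u) = 2"
  shows "\<exists>n\<ge>3. graph_iso V E (cycle_V n) (cycle_E n)"
proof -
  obtain v0 v1 where v01: "E v0 v1" using edges by (auto simp: edge_set_def)
  define other where "other a b = (SOME y. E b y \<and> y \<noteq> a)" for a b
  have other: "E b (other a b) \<and> other a b \<noteq> a" if "E a b" for a b
  proof -
    have "card (nb b) = 2" using reg adj_V that by blast
    then obtain x y where "nb b = {x, y}" "x \<noteq> y" by (auto simp: card_2_iff)
    then have "\<exists>y. E b y \<and> y \<noteq> a" by (metis insertCI nb_iff)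
    then show ?thesis unfolding other_def by (rule someI_ex)
  qed
  \<comment> \<open>The state is the pair of the current vertex and the next one, since continuing
    without turning back requires the previous vertex.\<close>
  define p where "p k = ((\<lambda>(a, b). (b, other a b)) ^^ k) (v0, v1)" for k :: nat
  define v where "v k = fst (p k)" for k
  have pS: "p (Suc k) = (snd (p k), other (fst (p k)) (snd (p k)))" for k
    by (simp add: p_def case_prod_beta)
  have vS: "v (Suc k) = snd (p k)" for k by (simp add: v_def pS)
  have adj: "E (v k) (v (Suc k))" for k
    unfolding vS unfolding v_def by (induction k) (use v01 other in \<open>auto simp: p_def case_prod_beta\<close>)
  have vSS: "v (Suc (Suc k)) = other (v k) (v (Suc k))" for k
    by (simp add: vS pS) (simp add: v_def)
  have ne: "v (Suc (Suc k)) \<noteq> v k" for k using other[OF adj[of k]] unfolding vSS by blast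
  have vV: "v k \<in> V" for k using adj adj_V by blast
  have two: "nb x = {a, b}" if "E x a" "E x b" "a \<noteq> b" for x a b
  proof -
    have "card (nb x) = 2" using reg adj_V that(1) by blast
    moreover have "{a, b} \<subseteq> nb x" "card {a, b} = 2" using that by auto
    ultimately show ?thesis using card_subset_eq[OF finite_nb] by metis
  qed
  have nbS: "nb (v (Suc k)) = {v k, v (Suc (Suc k))}" for k
    using two[of "v (Suc k)" "v k" "v (Suc (Suc k))"] adj adj_sym ne by metis
  define Q where "Q j \<longleftrightarrow> (\<exists>i<j. v i = v j)" for j
  have "\<not> inj v"
    using finite_imageD[of v UNIV] finite_subset[OF _ fin, of "range v"] vV infinite_UNIV_nat by auto
  then have "\<exists>j. Q j" unfolding Q_def inj_def by (metis nat_neq_iff)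
  then obtain n where n: "Q n" and least: "\<And>j. j < n \<Longrightarrow> \<not> Q j"
    using exists_least_iff[of Q] by blast
  have inj: "inj_on v {0..<n}"
    using least unfolding inj_on_def Q_def by (metis atLeastLessThan_iff nat_neq_iff)
  obtain i where i: "i < n" "v i = v n" using n by (auto simp: Q_def)
  \<comment> \<open>Otherwise the vertex before \<open>v n\<close> is a neighbour of
    \<open>v i\<close> and so equals its predecessor or its successor. The former contradicts
    minimality of \<open>n\<close>; the latter does so too, unless the walk turns back.\<close>
  have "i = 0"
  proof (rule ccontr)
    assume "i \<noteq> 0"
    then obtain i' where i': "i = Suc i'" by (cases i) auto
    obtain m where m: "n = Suc m" using i by (cases n) auto
    have "v m \<in> nb (v i)" using adj[of m] adj_sym i m by simp
    then have "v m = v i' \<or> v m = v (Suc i)" unfolding i' nbS by simp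
    moreover have "v m \<noteq> v i'" using inj i i' m unfolding inj_on_def by fastforce
    moreover have "v m \<noteq> v (Suc i)"
    proof
      assume "v m = v (Suc i)"
      moreover have "i \<noteq> m" using adj[of m] i m by auto
      ultimately have "m = Suc i" using inj i m unfolding inj_on_def by (metis atLeastLessThan_iff le0 lessI less_antisym Suc_mono)
      then show False using ne[of i] i m by simp
    qed
    ultimately show False by blast
  qed
  with i have vn: "v n = v 0" and "0 < n" by auto
  have n3: "3 \<le> n"
  proof -
    have "n \<noteq> 1" using adj[of 0] vn by auto
    moreover have "n \<noteq> 2" using ne[of 0] vn by (auto simp: eval_nat_numeral)
    ultimately show ?thesis using \<open>0 < n\<close> by linarith
  qed
  have nbv: "nb (v a) = {v ((a + 1) mod n), v ((a + n - 1) mod n)}" if "a < n" for a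
  proof (cases a)
    case 0
    obtain m where m: "n = Suc m" using \<open>0 < n\<close> by (cases n) auto
    have "v 1 \<noteq> v m" using inj n3 m unfolding inj_on_def by fastforce
    moreover have "E (v 0) (v 1)" "E (v 0) (v m)" using adj[of 0] adj[of m] adj_sym vn m by auto
    ultimately have "nb (v 0) = {v 1, v m}" using two by blast
    then show ?thesis using 0 m n3 by simp
  next
    case (Suc b)
    have "v (Suc (Suc b)) = v ((a + 1) mod n)"
      using that Suc vn by (cases "Suc (Suc b) = n") auto
    moreover have "(a + n - 1) mod n = b" using Suc that by simp
    ultimately show ?thesis unfolding Suc nbS by auto
  qed
  have img: "v ` {0..<n} = V"
  proof (rule adj_closed_eq_V)
    fix x y assume "x \<in> v ` {0..<n}" "E x y"
    then obtain a where "a < n" "y \<in> nb (v a)" by auto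
    then show "y \<in> v ` {0..<n}" unfolding nbv[OF \<open>a < n\<close>] using \<open>0 < n\<close> by auto
  qed (use vV \<open>0 < n\<close> in auto)
  have bij: "bij_betw v {0..<n} V" using inj img by (simp add: bij_betw_def)
  have EE: "E (v a) (v b) \<longleftrightarrow> cycle_E n a b" if "a < n" "b < n" for a b
  proof -
    have "E (v a) (v b) \<longleftrightarrow> v b = v ((a + 1) mod n) \<or> v b = v ((a + n - 1) mod n)"
      using nbv[OF that(1)] nb_iff[of "v b" "v a"] by simp
    also have "\<dots> \<longleftrightarrow> b = (a + 1) mod n \<or> b = (a + n - 1) mod n"
    proof -
      have "v b = v c \<longleftrightarrow> b = c" if "c < n" for c using inj that \<open>b < n\<close> by (auto simp: inj_on_def)
      then show ?thesis using \<open>0 < n\<close> by simp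
    qed
    also have "\<dots> \<longleftrightarrow> b \<in> {b \<in> cycle_V n. cycle_E n a b}" unfolding cycle_neighbours(1)[OF n3 that(1)] by simp
    also have "\<dots> \<longleftrightarrow> cycle_E n a b" using that by (simp add: cycle_V_def)
    finally show ?thesis .
  qed
  have "graph_iso V E (cycle_V n) (cycle_E n)"
    unfolding graph_iso_def
  proof (intro exI conjI ballI)
    show "bij_betw (inv_into {0..<n} v) V (cycle_V n)"
      unfolding cycle_V_def by (rule bij_betw_inv_into[OF bij])
    fix x y assume "x \<in> V" "y \<in> V"
    then obtain a b where "a < n" "b < n" "x = v a" "y = v b" using img by (metis atLeastLessThan_iff imageE)
    then show "E x y \<longleftrightarrow> cycle_E n (inv_into {0..<n} v x) (inv_into {0..<n} v y)"
      using EE inj by simp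
  qed
  then show ?thesis using n3 by blast
qed

end

section \<open>Graphs with a pendant vertex\<close>

text \<open>Listing the vertices in the order of their labels reduces an isomorphism with a concrete
  graph to a finite table of adjacencies.\<close>

lemma graph_isoI_distinct:
  assumes V: "V = set xs" and dist: "distinct xs" and W: "W = {0..<length xs}"
    and adj: "\<And>i j. i < length xs \<Longrightarrow> j < length xs \<Longrightarrow> E (xs ! i) (xs ! j) \<longleftrightarrow> F i j"
  shows "graph_iso V E W F"
proof -
  have bij: "bij_betw ((!) xs) {0..<length xs} (set xs)"
    using bij_betw_nth[OF dist, of "{0..<length xs}" "set xs"] by (simp add: atLeast0LessThan)
  let ?f = "inv_into {0..<length xs} ((!) xs)"
  have "bij_betw ?f V W" unfolding V W by (rule bij_betw_inv_into[OF bij])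
  moreover have "E u v \<longleftrightarrow> F (?f u) (?f v)" if uv: "u \<in> V" "v \<in> V" for u v
  proof -
    obtain i j where ij: "i < length xs" "u = xs ! i" "j < length xs" "v = xs ! j"
      using uv unfolding V in_set_conv_nth by metis
    then have "?f u = i" "?f v = j" using bij_betw_inv_into_left[OF bij] by simp_all
    then show ?thesis using adj[OF ij(1,3)] ij by simp
  qed
  ultimately show ?thesis unfolding graph_iso_def by blast
qed

context fin_graph
begin

lemma nb_eqI: "(\<And>x. E u x \<longleftrightarrow> x \<in> S) \<Longrightarrow> nb u = S"
  by (rule set_eqI) simp

lemma W2_empty: "nb u \<inter> nb v = {} \<Longrightarrow> W2 u v = 0" by (simp add: W2_def)
lemma W2_single: "nb u \<inter> nb v = {x} \<Longrightarrow> W2 u v = 1 / d x" by (simp add: W2_def)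
lemma W2_pair: "nb u \<inter> nb v = {x, y} \<Longrightarrow> x \<noteq> y \<Longrightarrow> W2 u v = 1 / d x + 1 / d y" by (simp add: W2_def)
lemma W3_pair: "nb u = {a, b} \<Longrightarrow> a \<noteq> b \<Longrightarrow> W3 u v = W2 a v / d a + W2 b v / d b" by (simp add: W3_def)

lemma d_ge: "S \<subseteq> nb u \<Longrightarrow> real (card S) \<le> d u"
  unfolding d_eq_card using card_mono[OF finite_nb] by simp

end

text \<open>All that is kept of the spectrum: one identity whose coefficients are unknown.\<close>

locale cubic_walk_graph = conn_graph +
  fixes k s1 s2 s3 :: real
  assumes k0: "k \<noteq> 0"
    and ident: "\<And>u v. u \<in> V \<Longrightarrow> v \<in> V \<Longrightarrow> W3 u v - s1 * W2 u v + s2 * (if E u v then 1 else 0)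
           - s3 * (if u = v then d u else 0) = k * d u * d v"
begin

lemma ident_diag: "u \<in> V \<Longrightarrow> W3 u u - s1 * W2 u u - s3 * d u = k * d u * d u"
  using ident[of u u] by simp

text \<open>Every walk from \<open>l\<close> starts with the step to \<open>w\<close>, so walks of
  length three become walks of length two from \<open>w\<close>. The row is multiplied by
  \<open>d w\<close>.\<close>

lemma leaf_row:
  assumes l: "nb l = {w}" and v: "v \<in> V"
  shows "W2 w v - s1 * (if E w v then 1 else 0) + s2 * d w * (if v = w then 1 else 0)
           - s3 * d w * (if v = l then 1 else 0) = k * d w * d v"
proof -
  have lw: "E l w" using l nb_iff by blast
  have lV: "l \<in> V" using lw adj_V by blast
  have dw: "d w > 0" using lw adj_sym d_pos by blast
  have dl: "d l = 1" using l by (simp add: d_eq_card)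
  define A B C :: real where "A = (if E w v then 1 else 0)" and "B = (if v = w then 1 else 0)"
    and "C = (if v = l then 1 else 0)"
  have "W2 l v = A / d w"
  proof (cases "E w v")
    case True
    then have "nb l \<inter> nb v = {w}" using l adj_sym by auto
    then show ?thesis using True by (simp add: W2_single A_def)
  next
    case False
    then have "nb l \<inter> nb v = {}" using l adj_sym by auto
    then show ?thesis using False by (simp add: W2_empty A_def)
  qed
  moreover have "W3 l v = W2 w v / d w" using l by (simp add: W3_def)
  moreover have "E l v \<longleftrightarrow> v = w" using l nb_iff by blast
  then have "(if E l v then 1 else 0) = B" "(if l = v then d l else 0) = C"
    using dl by (auto simp: B_def C_def)
  ultimately have "W2 w v / d w - s1 * (A / d w) + s2 * B - s3 * C = k * d v"
    using ident[OF lV v] dl by simp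
  then have "W2 w v - s1 * A + s2 * d w * B - s3 * d w * C = k * d w * d v"
    using dw by (simp add: field_simps)
  then show ?thesis unfolding A_def B_def C_def .
qed

lemma leaf_adj: "nb l = {w} \<Longrightarrow> E w l"
  by (rule adj_sym) (simp flip: nb_iff)

text \<open>The right-hand side is nonzero, so \<open>v\<close> has a common neighbour with
  \<open>w\<close>. The lemma applies to any pendant vertex, and is later used with roots other than
  \<open>w\<close>.\<close>

lemma leaf_far:
  assumes "nb l = {w}" "v \<in> V" "v \<noteq> w" "\<not> E w v"
  shows "W2 w v = k * d w * d v"
proof -
  have "v \<noteq> l" using leaf_adj[OF assms(1)] assms(4) by blast
  then show ?thesis using leaf_row[OF assms(1,2)] assms(3,4) by simp
qed

lemma leaf_near:
  assumes "nb l = {w}" "E w v" "v \<noteq> l"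
  shows "W2 w v - s1 = k * d w * d v"
proof -
  have "v \<noteq> w" "v \<in> V" using assms(2) adj_V by auto
  then show ?thesis using leaf_row[OF assms(1), of v] assms(2,3) by simp
qed

lemma leaf_self:
  assumes "nb l = {w}"
  shows "- s1 - s3 * d w = k * d w"
proof -
  have "E l w" using assms nb_iff by blast
  then have "E w l" "l \<in> V" "l \<noteq> w" using adj_sym adj_V by auto
  moreover have "W2 w l = 0" using assms by (intro W2_empty) auto
  moreover have "d l = 1" using assms by (simp add: d_eq_card)
  ultimately show ?thesis using leaf_row[OF assms, of l] by simp
qed

text \<open>Everything lies within distance two of the neighbour w of a leaf, so the breadth-first tree
  rooted at w has depth two and misses a single edge.\<close>

lemma leaf_tree_exists:
  assumes leaf: "nb l = {w}" and ce: "card (edge_set E) = card V"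
  obtains par p q where "\<And>v. E w v \<Longrightarrow> par v = w"
    "\<And>v. v \<in> V \<Longrightarrow> v \<noteq> w \<Longrightarrow> \<not> E w v \<Longrightarrow> E w (par v)"
    "E p q" "p \<noteq> w" "q \<noteq> w"
    "\<And>u v. E u v \<longleftrightarrow> u \<in> V \<and> v \<in> V \<and>
       ((u \<noteq> w \<and> v = par u) \<or> (v \<noteq> w \<and> u = par v) \<or> (u = p \<and> v = q) \<or> (u = q \<and> v = p))"
    "par p \<noteq> q" "par q \<noteq> p"
proof -
  have wV: "w \<in> V" using leaf nb_iff adj_V by blast
  \<comment> \<open>Vertices of the second level choose a parent arbitrarily. The value at
    \<open>w\<close> itself is meaningless, hence the conditions excluding \<open>w\<close>.\<close>
  define par where "par v = (if E w v then w else SOME y. E w y \<and> E y v)" for v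
  have par_N: "par v = w" if "E w v" for v using that by (simp add: par_def)
  have par_far: "E w (par v) \<and> E (par v) v" if "v \<in> V" "v \<noteq> w" "\<not> E w v" for v
  proof -
    have "W2 w v \<noteq> 0" using leaf_far[OF leaf that] k0 d_pos_V[OF wV] d_pos_V[OF that(1)] by simp
    then have "nb w \<inter> nb v \<noteq> {}" using W2_empty by blast
    then have "\<exists>y. E w y \<and> E y v" using adj_sym by auto
    from someI_ex[OF this] show ?thesis using that(3) by (simp add: par_def)
  qed
  have par_adj: "E v (par v)" if "v \<in> V" "v \<noteq> w" for v
    using par_N par_far that adj_sym by metis
  define T where "T = (\<lambda>v. {v, par v}) ` (V - {w})"
  \<comment> \<open>Two vertices cannot be parents of each other: a parent other than
    \<open>w\<close> is adjacent to \<open>w\<close> and so has \<open>w\<close> as its own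
    parent.\<close>
  have "inj_on (\<lambda>v. {v, par v}) (V - {w})"
  proof (rule inj_onI, rule ccontr)
    fix u v assume uv: "u \<in> V - {w}" "v \<in> V - {w}" "{u, par u} = {v, par v}" "u \<noteq> v"
    then have *: "u = par v" "v = par u" by (auto simp: doubleton_eq_iff)
    then have n: "\<not> E w u" "\<not> E w v" using uv(1,2) par_N by fastforce+
    then have "E w (par u)" using par_far[of u] uv(1) by blast
    then show False using n(2) unfolding *(2)[symmetric] by blast
  qed
  then have cT: "card T = card V - 1" unfolding T_def using wV fin by (simp add: card_image)
  have TE: "T \<subseteq> edge_set E" using par_adj by (auto simp: T_def edge_set_def)
  have "edge_set E \<subseteq> Pow V" using adj_V by (auto simp: edge_set_def)
  then have finE: "finite (edge_set E)" using fin by (meson finite_Pow_iff finite_subset)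
  have "card V > 0" using wV fin by (auto simp: card_gt_0_iff)
  \<comment> \<open>Exactly \<open>card V - 1\<close> of the \<open>card V\<close> edges belong to
    the tree.\<close>
  then have "card (edge_set E - T) = 1"
    using card_Diff_subset[OF finite_subset[OF TE finE] TE] cT ce by simp
  then obtain e where e: "edge_set E - T = {e}" by (auto simp: card_1_singleton_iff)
  then have "e \<in> edge_set E" by blast
  then obtain p q where pq: "e = {p, q}" "E p q" by (auto simp: edge_set_def)
  have eT: "{p, q} \<notin> T" using e pq by blast
  have notT: "{v, par v} \<in> T" if "v \<in> V" "v \<noteq> w" for v using that by (auto simp: T_def)
  have pqV: "p \<in> V" "q \<in> V" using pq(2) adj_V by auto
  \<comment> \<open>All edges at \<open>w\<close> are tree edges, so the extra edge avoids
    \<open>w\<close>.\<close>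
  have pw: "p \<noteq> w"
  proof
    assume "p = w"
    then have "par q = p" "q \<noteq> w" using par_N pq(2) by auto
    then show False using eT notT[of q] pqV by (metis insert_commute)
  qed
  have qw: "q \<noteq> w"
  proof
    assume "q = w"
    then have "par p = q" "p \<noteq> w" using par_N pq(2) adj_sym by auto
    then show False using eT notT[of p] pqV by metis
  qed
  have adj: "E u v \<longleftrightarrow> u \<in> V \<and> v \<in> V \<and>
       ((u \<noteq> w \<and> v = par u) \<or> (v \<noteq> w \<and> u = par v) \<or> (u = p \<and> v = q) \<or> (u = q \<and> v = p))" for u v
  proof
    assume uv: "E u v"
    then have "{u, v} \<in> edge_set E" by (auto simp: edge_set_def)
    then have "{u, v} \<in> T \<or> {u, v} \<in> edge_set E - T" by simp
    then consider "{u, v} \<in> T" | "{u, v} = {p, q}" unfolding e pq(1) by auto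
    then have "(u \<noteq> w \<and> v = par u) \<or> (v \<noteq> w \<and> u = par v) \<or> (u = p \<and> v = q) \<or> (u = q \<and> v = p)"
    proof cases
      case 1
      then obtain x where "x \<noteq> w" "{u, v} = {x, par x}" unfolding T_def by blast
      then show ?thesis unfolding doubleton_eq_iff by metis
    next
      case 2
      then show ?thesis unfolding doubleton_eq_iff by metis
    qed
    then show "u \<in> V \<and> v \<in> V \<and>
       ((u \<noteq> w \<and> v = par u) \<or> (v \<noteq> w \<and> u = par v) \<or> (u = p \<and> v = q) \<or> (u = q \<and> v = p))"
      using adj_V[OF uv] by blast
  next
    assume "u \<in> V \<and> v \<in> V \<and>
       ((u \<noteq> w \<and> v = par u) \<or> (v \<noteq> w \<and> u = par v) \<or> (u = p \<and> v = q) \<or> (u = q \<and> v = p))"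
    then show "E u v" using par_adj adj_sym pq(2) by blast
  qed
  have ne: "par p \<noteq> q" "par q \<noteq> p" using eT notT[of p] notT[of q] pqV pw qw by (metis, metis insert_commute)
  show thesis
    by (rule that[of par p q]) (use par_N par_far pq(2) pw qw adj ne in blast)+
qed

end

text \<open>w is the root, l a leaf at the root, par the parent map of the tree and pq the one edge outside
  the tree.\<close>

locale leaf_tree = cubic_walk_graph +
  fixes l w :: 'a and par :: "'a \<Rightarrow> 'a" and p q :: 'a
  assumes leaf: "nb l = {w}"
    and par_N: "\<And>v. E w v \<Longrightarrow> par v = w"
    and par_far: "\<And>v. v \<in> V \<Longrightarrow> v \<noteq> w \<Longrightarrow> \<not> E w v \<Longrightarrow> E w (par v)"
    and pq: "E p q" "p \<noteq> w" "q \<noteq> w"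
    and adj: "\<And>u v. E u v \<longleftrightarrow> u \<in> V \<and> v \<in> V \<and>
       ((u \<noteq> w \<and> v = par u) \<or> (v \<noteq> w \<and> u = par v) \<or> (u = p \<and> v = q) \<or> (u = q \<and> v = p))"
    and pq_not_par: "par p \<noteq> q" "par q \<noteq> p"
begin

definition far :: "'a \<Rightarrow> bool" where "far z \<longleftrightarrow> z \<in> V \<and> z \<noteq> w \<and> \<not> E w z"

text \<open>Lets arguments about \<open>p\<close> be reused for \<open>q\<close>.\<close>

lemma swap: "leaf_tree V E k s1 s2 s3 l w par q p"
proof unfold_locales
  show "E u v \<longleftrightarrow> u \<in> V \<and> v \<in> V \<and>
       ((u \<noteq> w \<and> v = par u) \<or> (v \<noteq> w \<and> u = par v) \<or> (u = q \<and> v = p) \<or> (u = p \<and> v = q))" for u v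
    using adj[of u v] by blast
qed (use leaf par_N par_far pq pq_not_par adj_sym in auto)

lemma wl: "E w l" and lV: "l \<in> V" and wV: "w \<in> V" and l_adj: "E l x \<longleftrightarrow> x = w"
proof -
  show "E l x \<longleftrightarrow> x = w" for x using leaf nb_iff by blast
  then have "E l w" by blast
  then show "E w l" "l \<in> V" "w \<in> V" using adj_sym adj_V by auto
qed

lemma p_ne_q: "p \<noteq> q" using pq(1) by auto

lemma dw_pos: "d w > 0" using d_pos_V[OF wV] .

lemma dl: "d l = 1" using leaf by (simp add: d_eq_card)

lemma N_adj: "E w y \<Longrightarrow> E y x \<longleftrightarrow> x = w \<or> (far x \<and> par x = y) \<or> (y = p \<and> x = q) \<or> (y = q \<and> x = p)"
  using adj[of y x] par_N[of y] par_N[of x] adj_V[of w y] adj_V[OF pq(1)] wV unfolding far_def by auto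

lemma far_adj: "far z \<Longrightarrow> E z x \<longleftrightarrow> x = par z \<or> (z = p \<and> x = q) \<or> (z = q \<and> x = p)"
  using adj[of z x] par_N[of x] par_far[of x] par_far[of z] adj_V[of w "par z"] adj_V[OF pq(1)]
  unfolding far_def by auto

lemma far_par: "far z \<Longrightarrow> E w (par z)" using par_far by (simp add: far_def)

lemma far_leaf: "far z \<Longrightarrow> z \<noteq> p \<Longrightarrow> z \<noteq> q \<Longrightarrow> nb z = {par z}"
  using far_adj by auto

lemma far_par_adj: "far z \<Longrightarrow> E (par z) z"
  using far_adj adj_sym by blast

lemma far_par_ne_l: "far z \<Longrightarrow> par z \<noteq> l"
  using far_par_adj l_adj by (auto simp: far_def)

lemma N_not_far: "E w y \<Longrightarrow> \<not> far y" by (simp add: far_def)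

lemma V_cases: "x \<in> V \<Longrightarrow> x = w \<or> E w x \<or> far x" by (auto simp: far_def)

lemma p_ne_l: "p \<noteq> l" and q_ne_l: "q \<noteq> l" using l_adj pq adj_sym[OF pq(1)] by auto

text \<open>Here \<open>w\<close>, \<open>p\<close>, \<open>q\<close> and \<open>par q\<close> form
  a 4-cycle and no two neighbours of \<open>w\<close> are adjacent. The row of \<open>l\<close> then
  gives all neighbours of \<open>w\<close> except \<open>l\<close> one common degree
  \<open>D\<close>.\<close>

lemma extra_edge_not_between_levels:
  assumes p: "E w p" and q: "far q"
  shows False
proof -
  define y where "y = par q"
  have wy: "E w y" using far_par[OF q] by (simp add: y_def)
  have yp: "y \<noteq> p" using pq_not_par by (simp add: y_def)
  have yl: "y \<noteq> l" using far_par_ne_l[OF q] by (simp add: y_def)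
  have pf: "\<not> far p" using p N_not_far by blast
  have ww: "nb w \<inter> nb x = {}" if "E w x" for x
    using N_adj[OF that] that N_not_far q by auto
  have near: "- s1 = k * d w * d x" if "E w x" "x \<noteq> l" for x
    using leaf_near[OF leaf that] W2_empty[OF ww[OF that(1)]] by simp
  have nbq: "nb q = {y, p}"
    by (rule nb_eqI) (use p_ne_q in \<open>auto simp: far_adj[OF q] y_def\<close>)
  define D where "D = d p"
  have dwD: "k * d w * d x = k * d w * D" if "E w x" "x \<noteq> l" for x
    using near[OF that] near[OF p p_ne_l] unfolding D_def by linarith
  have dx: "d x = D" if "E w x" "x \<noteq> l" for x
    using dwD[OF that] k0 dw_pos by simp
  have D0: "D > 0" using d_pos[OF pq(1)] by (simp add: D_def)
  have dq: "d q = 2" using nbq yp by (simp add: d_eq_card)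
  have "nb w \<inter> nb q = {y, p}" using nbq wy p by auto
  then have "W2 w q = 1 / D + 1 / D" using W2_pair yp dx[OF wy yl] by (simp add: D_def)
  moreover have qf: "q \<in> V" "q \<noteq> w" "\<not> E w q" using q by (auto simp: far_def)
  ultimately have kD: "k * d w * D = 1" using leaf_far[OF leaf qf] dq D0 by (simp add: field_simps)
  then have s1: "s1 = - 1" using near[OF p p_ne_l] by (simp add: D_def)
  have "card {l, p, y} = 3" using p_ne_l yl yp by auto
  then have dw3: "d w \<ge> 3" using d_ge[of "{l, p, y}" w] wl p wy by simp
  have W2q: "W2 x q = 0" if "E w x" for x
    using ww[OF that] nbq wy p by (intro W2_empty) auto
  \<comment> \<open>Another vertex of the second level would be pendant, and its own row at
    \<open>q\<close> forces either \<open>d w = 2\<close> or \<open>k = 0\<close>.\<close>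
  have only: "z = q" if z: "far z" for z
  proof (rule ccontr)
    assume zq: "z \<noteq> q"
    have "z \<noteq> p" using z pf by blast
    then have nz: "nb z = {par z}" using far_leaf z zq by blast
    have wpz: "E w (par z)" using far_par[OF z] .
    have dz: "d (par z) = D" using dx[OF wpz far_par_ne_l[OF z]] .
    show False
    proof (cases "E (par z) q")
      case True
      then have "1 = k * D * 2" using leaf_near[OF nz True] zq W2q[OF wpz] s1 dz dq by simp
      then have "d w = 2 * (k * d w * D)" by (metis mult.commute mult.left_commute mult.right_neutral)
      then show False using kD dw3 by simp
    next
      case False
      have "q \<noteq> par z" using q wpz N_not_far by blast
      then show False using leaf_far[OF nz qf(1) _ False] W2q[OF wpz] dz dq D0 k0 by simp
    qed
  qed
  have "\<not> (far x \<and> par x = p)" for x using only[of x] pq_not_par by blast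
  then have nbp: "nb p = {w, q}"
    by (intro nb_eqI) (use p_ne_q in \<open>auto simp: N_adj[OF p]\<close>)
  have D2: "D = 2" using nbp qf by (simp add: D_def d_eq_card)
  \<comment> \<open>Both \<open>p\<close> and \<open>q\<close> have degree 2 and lie on no triangle,
    so comparing their diagonal entries eliminates \<open>s3\<close> and \<open>k\<close> and leaves
    an equation for \<open>d w\<close>.\<close>
  have "W2 p p = 1 / d w + 1 / 2" using W2_pair[of p p w q] nbp qf dq by simp
  moreover have "nb q \<inter> nb p = {}" using nbp nbq pq yp wy qf p by auto
  then have "W3 p p = 0" using W3_pair[OF nbp] qf W2_empty[OF ww[OF p]] by (simp add: W2_empty)
  moreover have "W2 q q = 1" using W2_pair[of q q y p] nbq yp dx[OF wy yl] D2 by (simp add: D_def)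
  moreover have "W3 q q = 0" using W3_pair[OF nbq yp, of q] W2q[OF wy] W2q[OF p] by simp
  ultimately have "1 / d w + 1 / 2 = 1"
    using ident_diag[of p] ident_diag[OF qf(1)] dq D2 s1 adj_V[OF pq(1)] by (simp add: D_def)
  then show False using dw3 by (simp add: field_simps)
qed

text \<open>The extra edge closes a triangle hanging at a common parent, or a 5-cycle through
  \<open>w\<close>. In both cases the neighbours of \<open>w\<close> other than \<open>l\<close>
  share a degree \<open>D\<close>, which fixes \<open>s1\<close>.\<close>

lemma extra_edge_not_in_last_level:
  assumes p: "far p" and q: "far q"
  shows False
proof -
  have ww: "nb w \<inter> nb x = {}" if "E w x" for x
    using N_adj[OF that] that N_not_far p q by auto
  have near: "- s1 = k * d w * d x" if "E w x" "x \<noteq> l" for x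
    using leaf_near[OF leaf that] W2_empty[OF ww[OF that(1)]] by simp
  define y where "y = par p"
  have wy: "E w y" "y \<noteq> l" using far_par[OF p] far_par_ne_l[OF p] by (auto simp: y_def)
  define D where "D = d y"
  have dx: "d x = D" if "E w x" "x \<noteq> l" for x
  proof -
    have "k * d w * d x = k * d w * D" using near[OF that] near[OF wy] unfolding D_def by linarith
    then show ?thesis using k0 dw_pos by simp
  qed
  have D0: "D > 0" using d_pos[OF adj_sym[OF wy(1)]] by (simp add: D_def)
  have pw: "\<not> E w p" "\<not> E w q" "p \<in> V" "q \<in> V" using p q by (auto simp: far_def)
  have nbp: "nb p = {y, q}" by (rule nb_eqI) (use p_ne_q in \<open>auto simp: far_adj[OF p] y_def\<close>)
  have nbq: "nb q = {par q, p}" by (rule nb_eqI) (use p_ne_q in \<open>auto simp: far_adj[OF q]\<close>)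
  have yq: "y \<noteq> q" "par q \<noteq> p" using pq_not_par by (auto simp: y_def)
  have dp: "d p = 2" "d q = 2" using nbp nbq yq by (simp_all add: d_eq_card)
  have "nb w \<inter> nb p = {y}" using nbp wy pw by auto
  then have kD: "1 / D = 2 * k * d w"
    using leaf_far[OF leaf pw(3) pq(2) pw(1)] W2_single dp by (simp add: D_def)
  \<comment> \<open>The row of \<open>l\<close> at a pendant \<open>z\<close> has half the
    right-hand side of that at \<open>p\<close>, but the same left-hand side
    \<open>1 / D\<close>.\<close>
  have only: "z = p \<or> z = q" if z: "far z" for z
  proof (rule ccontr)
    assume "\<not> ?thesis"
    then have nz: "nb z = {par z}" using far_leaf z by blast
    have "nb w \<inter> nb z = {par z}" using nz far_par[OF z] by auto
    then have "W2 w z = 1 / D" using W2_single dx[OF far_par[OF z] far_par_ne_l[OF z]] by simp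
    moreover have "d z = 1" using nz by (simp add: d_eq_card)
    moreover have "z \<in> V" "z \<noteq> w" "\<not> E w z" using z by (auto simp: far_def)
    ultimately have "1 / D = k * d w" using leaf_far[OF leaf, of z] by simp
    then show False using kD k0 dw_pos by simp
  qed
  have kD': "k * d w * D = 1 / 2" using kD D0 by (simp add: field_simps)
  have s1: "s1 = - 1 / 2" using near[OF wy] kD' by (simp add: D_def)
  have s3: "1 / 2 - s3 * d w = k * d w" using leaf_self[OF leaf] s1 by simp
  show False
  proof (cases "par q = y")
    \<comment> \<open>Triangle on \<open>y\<close>, \<open>p\<close>, \<open>q\<close>: the diagonal
      entry at \<open>p\<close> gives \<open>d w\<close> = 16/9, less than 2.\<close>
    case True
    have "(far x \<and> par x = y) \<longleftrightarrow> x = p \<or> x = q" for x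
      using only[of x] p q True unfolding y_def by metis
    then have nby: "nb y = {w, p, q}"
      by (intro nb_eqI) (use wy pw in \<open>auto simp: N_adj[OF wy(1)]\<close>)
    have D3: "D = 3" using nby pq p_ne_q by (simp add: D_def d_eq_card)
    have "nb y \<inter> nb p = {q}" "nb q \<inter> nb p = {y}" using nby nbp nbq True yq pq p_ne_q wy by auto
    then have "W3 p p = 1 / 3" using W3_pair[OF nbp yq(1), of p] D3 dp by (simp add: W2_single D_def)
    moreover have "W2 p p = 5 / 6" using W2_pair[of p p y q] nbp yq D3 dp by (simp add: D_def)
    ultimately have "3 / 4 - 2 * s3 = 4 * k" using ident_diag[OF pw(3)] dp s1 by simp
    then have "3 / 4 * d w - 2 * (s3 * d w) = 4 * (k * d w)" by algebra
    moreover have kw: "k * d w = 1 / 6" using kD' D3 by simp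
    moreover have "s3 * d w = 1 / 3" using s3 kw by simp
    ultimately have "3 / 4 * d w = 4 / 3" by linarith
    moreover have "card {l, y} = 2" using wy by auto
    then have "d w \<ge> 2" using d_ge[of "{l, y}" w] wl wy by simp
    ultimately show False by simp
  next
    \<comment> \<open>5-cycle: \<open>p\<close> and \<open>y\<close> have degree 2 and lie on no
      triangle, so equating their diagonal entries gives \<open>d w = 2\<close>.\<close>
    case False
    have "(far x \<and> par x = y) \<longleftrightarrow> x = p" for x
      using only[of x] p q False unfolding y_def by metis
    then have nby: "nb y = {w, p}"
      by (intro nb_eqI) (use wy pw in \<open>auto simp: N_adj[OF wy(1)]\<close>)
    have D2: "D = 2" using nby pq by (simp add: D_def d_eq_card)
    have e: "nb y \<inter> nb p = {}" "nb q \<inter> nb p = {}" "nb p \<inter> nb y = {}"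
    proof -
      have "y \<noteq> w" "y \<noteq> p" "par q \<noteq> q" using wy pw far_par[OF q] by auto
      then show "nb y \<inter> nb p = {}" "nb q \<inter> nb p = {}" "nb p \<inter> nb y = {}"
        unfolding nby nbp nbq using False pq(2,3) p_ne_q by auto
    qed
    then have "W3 p p = 0" using W3_pair[OF nbp yq(1), of p] by (simp add: W2_empty)
    moreover have "W2 p p = 1" using W2_pair[of p p y q] nbp yq D2 dp by (simp add: D_def)
    moreover have "W3 y y = 0" using W3_pair[OF nby, of y] pq e ww[OF wy(1)] by (simp add: W2_empty)
    moreover have "W2 y y = 1 / d w + 1 / 2" using W2_pair[of y y w p] nby pq dp by simp
    ultimately have "(1 / d w + 1 / 2) / 2 - s3 * 2 = 1 / 2 - s3 * 2"
      using ident_diag[OF pw(3)] ident_diag[of y] adj_V[OF wy(1)] dp s1 D2 by (simp add: D_def)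
    then have "1 / d w + 1 / 2 = 1" by simp
    moreover have "card {l, y, par q} = 3" using wy False far_par_ne_l[OF q] by auto
    then have "d w \<ge> 3" using d_ge[of "{l, y, par q}" w] wl wy far_par[OF q] by simp
    ultimately show False by (simp add: field_simps)
  qed
qed

section \<open>The remaining case: \<open>w\<close>, \<open>p\<close> and \<open>q\<close> form a
  triangle\<close>

lemma triangle_facts:
  assumes p: "E w p" and q: "E w q"
  shows "far z \<Longrightarrow> nb z = {par z}" "nb w \<inter> nb p = {q}" "nb w \<inter> nb q = {p}"
    "E w y \<Longrightarrow> y \<noteq> p \<Longrightarrow> y \<noteq> q \<Longrightarrow> nb w \<inter> nb y = {}"
    "far z \<Longrightarrow> 1 / d (par z) = k * d w" "d w \<ge> 3"
proof -
  have pq_far: "\<not> far p" "\<not> far q" using p q N_not_far by auto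
  show leafz: "nb z = {par z}" if "far z" for z
    using far_leaf[OF that] that pq_far by metis
  have "x \<in> nb w \<inter> nb p \<longleftrightarrow> x \<in> {q}" for x
    using N_adj[OF p, of x] q p_ne_q N_not_far[of x] by auto
  then show "nb w \<inter> nb p = {q}" by (rule set_eqI)
  have "x \<in> nb w \<inter> nb q \<longleftrightarrow> x \<in> {p}" for x
    using N_adj[OF q, of x] p p_ne_q N_not_far[of x] by auto
  then show "nb w \<inter> nb q = {p}" by (rule set_eqI)
  show "nb w \<inter> nb y = {}" if "E w y" "y \<noteq> p" "y \<noteq> q"
  proof -
    have "x \<in> nb w \<inter> nb y \<longleftrightarrow> x \<in> {}" for x
      using N_adj[OF that(1), of x] that N_not_far[of x] by auto
    then show ?thesis by (rule set_eqI)
  qed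
  show "1 / d (par z) = k * d w" if z: "far z"
  proof -
    have "nb w \<inter> nb z = {par z}" using leafz[OF z] far_par[OF z] by simp
    then have "W2 w z = 1 / d (par z)" by (rule W2_single)
    moreover have "d z = 1" using leafz[OF z] by (simp add: d_eq_card)
    moreover have "z \<in> V" "z \<noteq> w" "\<not> E w z" using z by (auto simp: far_def)
    ultimately show ?thesis using leaf_far[OF leaf, of z] by simp
  qed
  have "card {l, p, q} = 3" using p_ne_l q_ne_l p_ne_q by auto
  then show "d w \<ge> 3" using d_ge[of "{l, p, q}" w] wl p q by simp
qed

lemma triangle_no_far_imp_U21:
  assumes p: "E w p" and q: "E w q" and none: "\<And>z. \<not> far z"
  shows "graph_iso V E U21_V U21_E"
proof -
  note tri = triangle_facts[OF p q]
  have nbp: "nb p = {w, q}" by (rule nb_eqI) (use none p_ne_q in \<open>auto simp: N_adj[OF p]\<close>)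
  have nbq: "nb q = {w, p}" by (rule nb_eqI) (use none p_ne_q in \<open>auto simp: N_adj[OF q]\<close>)
  have dpq: "d p = 2" "d q = 2" using nbp nbq pq by (simp_all add: d_eq_card)
  have only: "y \<in> {l, p, q}" if wy: "E w y" for y
  proof (rule ccontr)
    assume "y \<notin> {l, p, q}"
    then have y: "y \<noteq> l" "y \<noteq> p" "y \<noteq> q" by auto
    have "nb y = {w}" by (rule nb_eqI) (use none y in \<open>auto simp: N_adj[OF wy]\<close>)
    then have dy: "d y = 1" by (simp add: d_eq_card)
    \<comment> \<open>A second leaf at \<open>w\<close>, next to the entry at \<open>p\<close>,
      determines \<open>k * d w\<close>, \<open>s1\<close> and \<open>s3\<close>; the diagonal entry
      at \<open>p\<close> then gives \<open>d w = 2\<close>.\<close>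
    have a: "- s1 = k * d w" using leaf_near[OF leaf wy y(1)] W2_empty[OF tri(4)[OF wy y(2,3)]] dy by simp
    have b: "1 / 2 - s1 = k * d w * 2" using leaf_near[OF leaf p p_ne_l] W2_single[OF tri(2)] dpq by simp
    have kw: "k * d w = 1 / 2" and s1: "s1 = - 1 / 2" using a b by linarith+
    have "s3 * d w = 0" using leaf_self[OF leaf] a by linarith
    then have s3: "s3 = 0" using dw_pos by simp
    have "nb q \<inter> nb p = {w}" unfolding nbp nbq using p_ne_q pq by auto
    then have "W3 p p = 1 / d w" using W3_pair[OF nbp, of p] pq(3) W2_single[OF tri(2)] dpq by (simp add: W2_single)
    moreover have "W2 p p = 1 / d w + 1 / 2" using W2_pair[of p p w q] nbp pq(3) dpq by simp
    ultimately have "1 / d w + (1 / d w + 1 / 2) / 2 = 4 * k"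
      using ident_diag[of p] adj_V[OF pq(1)] s1 s3 dpq by simp
    then have "(1 / d w + (1 / d w + 1 / 2) / 2) * d w = 4 * (k * d w)" by simp
    then have "d w = 2" unfolding kw using dw_pos by (simp add: field_simps)
    then show False using tri(6) by simp
  qed
  have Vset: "V = set [w, p, q, l]"
    using V_cases none only adj_V[OF p] adj_V[OF q] adj_V[OF wl] by auto
  have facts: "E w p" "E p w" "E w q" "E q w" "E w l" "E l w" "E p q" "E q p"
     "\<not> E l p" "\<not> E p l" "\<not> E l q" "\<not> E q l"
    using p q wl pq(1) adj_sym l_adj pq(2,3) by auto
  show ?thesis
  proof (rule graph_isoI_distinct[OF Vset])
    show "distinct [w, p, q, l]" using pq p_ne_q p_ne_l q_ne_l wl by auto
    show "U21_V = {0..<length [w, p, q, l]}" by (auto simp: U21_V_def)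
    fix i j assume "i < length [w, p, q, l]" "j < length [w, p, q, l]"
    then have "i \<in> {0, 1, 2, 3}" "j \<in> {0, 1, 2, 3}" by auto
    then show "E ([w, p, q, l] ! i) ([w, p, q, l] ! j) \<longleftrightarrow> U21_E i j"
      using facts by (elim insertE emptyE; simp add: U21_E_def doubleton_eq_iff)
  qed
qed

text \<open>With any other parent \<open>y\<close>, the row of the pendant vertex \<open>z\<close>
  can be read at \<open>l\<close> and at \<open>p\<close>. Both share only \<open>w\<close> with
  \<open>y\<close>, so they have equal degree, but \<open>p\<close> lies on the triangle.\<close>

lemma triangle_far_par:
  assumes p: "E w p" and q: "E w q" and z: "far z"
  shows "par z = p \<or> par z = q"
proof (rule ccontr)
  assume ne: "\<not> ?thesis"
  note tri = triangle_facts[OF p q]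
  define y where "y = par z"
  have wy: "E w y" "y \<noteq> l" and y: "y \<noteq> p" "y \<noteq> q"
    using far_par[OF z] far_par_ne_l[OF z] ne by (auto simp: y_def)
  have nz: "nb z = {y}" using tri(1)[OF z] by (simp add: y_def)
  have "\<not> E y l" using l_adj adj_sym wy by fastforce
  moreover have "x \<in> nb y \<inter> nb l \<longleftrightarrow> x \<in> {w}" for x
    using l_adj[of x] adj_sym[OF wy(1)] by auto
  then have "nb y \<inter> nb l = {w}" by (rule set_eqI)
  ultimately have 1: "1 / d w = k * d y" using leaf_far[OF nz lV] W2_single wy dl by simp
  have "\<not> E y p" using N_adj[OF wy(1), of p] y pq N_not_far[OF p] by auto
  moreover have "x \<in> nb y \<inter> nb p \<longleftrightarrow> x \<in> {w}" for x
    using N_adj[OF wy(1), of x] N_adj[OF p, of x] y q N_not_far[of x] by auto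
  then have "nb y \<inter> nb p = {w}" by (rule set_eqI)
  ultimately have 2: "1 / d w = k * d y * d p"
    using leaf_far[OF nz, of p] W2_single[of y p w] y adj_V[OF pq(1)] by simp
  have "1 / d w \<noteq> 0" using dw_pos by simp
  then have "d p = 1" using 1 2 by simp
  moreover have "card {w, q} = 2" using pq by auto
  then have "d p \<ge> 2" using d_ge[of "{w, q}" p] adj_sym[OF p] pq by simp
  ultimately show False by simp
qed

text \<open>The rows of \<open>l\<close>, of \<open>z\<close> and of a pendant vertex at
  \<open>q\<close> make the degrees of \<open>w\<close>, \<open>p\<close>, \<open>q\<close> equal;
  their common value is 3 once \<open>w\<close> has no further neighbours.\<close>

lemma triangle_far_imp_U4111:
  assumes p: "E w p" and q: "E w q" and z: "far z" and zp: "par z = p"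
  shows "graph_iso V E U4111_V U4111_E"
proof -
  note tri = triangle_facts[OF p q]
  have nz: "nb z = {p}" using tri(1)[OF z] zp by simp
  have kp: "1 / d p = k * d w" using tri(5)[OF z] zp by simp
  have dp0: "d p > 0" "d q > 0" using d_pos[OF pq(1)] d_pos[OF adj_sym[OF pq(1)]] .
  have kpw: "k * d w * d p = 1" using kp dp0 by (simp add: field_simps)
  have np: "1 / d q - s1 = 1" using leaf_near[OF leaf p p_ne_l] W2_single[OF tri(2)] kpw by simp
  have zq: "q \<noteq> z" using z q N_not_far by blast
  \<comment> \<open>If \<open>q\<close> had no child, its degree 2 would force
    \<open>d p = 2\<close>, and the row of \<open>z\<close> at \<open>q\<close> would give
    \<open>d w = 2\<close>.\<close>
  have "\<exists>z2. far z2 \<and> par z2 = q"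
  proof (rule ccontr)
    assume none: "\<nexists>z2. far z2 \<and> par z2 = q"
    have nbq: "nb q = {w, p}" by (rule nb_eqI) (use none p_ne_q in \<open>auto simp: N_adj[OF q]\<close>)
    then have dq: "d q = 2" using pq by (simp add: d_eq_card)
    have s1: "s1 = - 1 / 2" using np dq by simp
    have "1 / d p - s1 = k * d w * 2" using leaf_near[OF leaf q q_ne_l] W2_single[OF tri(3)] dq by simp
    then have "1 / d p = 1 / 2" using s1 kp by linarith
    then have dp: "d p = 2" using dp0 by (simp add: field_simps)
    then have kw: "k * d w = 1 / 2" using kp by simp
    have "nb p \<inter> nb q = {w}" unfolding nbq using adj_sym[OF p] by auto
    then have "1 / d w + 1 / 2 = 4 * k" using leaf_near[OF nz pq(1) zq] W2_single[of p q w] dp dq s1 by simp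
    then have "(1 / d w + 1 / 2) * d w = 4 * (k * d w)" by simp
    then have "d w = 2" unfolding kw using dw_pos by (simp add: field_simps)
    then show False using tri(6) by simp
  qed
  then obtain z2 where z2: "far z2" and z2q: "par z2 = q" by blast
  have nz2: "nb z2 = {q}" using tri(1)[OF z2] z2q by simp
  have kq: "1 / d q = k * d w" using tri(5)[OF z2] z2q by simp
  have "1 / d q = 1 / d p" unfolding kp kq ..
  then have dpq: "d q = d p" by simp
  have zz2: "z \<noteq> z2" using zp z2q p_ne_q by auto
  have pz2: "\<not> E p z2" using N_adj[OF p, of z2] z2 z2q p_ne_q p q N_not_far by (auto simp: far_def)
  have qz: "\<not> E q z" using N_adj[OF q, of z] z zp p_ne_q p q N_not_far by (auto simp: far_def)
  \<comment> \<open>The row of \<open>z\<close> at \<open>z2\<close> yields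
    \<open>1 / d q = k * d p\<close>; the row of \<open>l\<close> at \<open>z2\<close> yields
    \<open>1 / d q = k * d w\<close>.\<close>
  have "nb p \<inter> nb z2 = {q}" unfolding nz2 using pq(1) by auto
  moreover have "d z2 = 1" using nz2 by (simp add: d_eq_card)
  moreover have "z2 \<in> V" "z2 \<noteq> p" "z2 \<noteq> q" using z2 p q by (auto simp: far_def)
  ultimately have "1 / d q = k * d p" using leaf_far[OF nz, of z2] W2_single[of p z2 q] pz2 by simp
  then have "k * d p = k * d w" using kq by linarith
  then have dpw: "d p = d w" using k0 by simp
  have only: "y \<in> {l, p, q}" if wy: "E w y" for y
  proof (rule ccontr)
    assume "y \<notin> {l, p, q}"
    then have y: "y \<noteq> l" "y \<noteq> p" "y \<noteq> q" by auto
    have "\<not> (far x \<and> par x = y)" for x using triangle_far_par[OF p q, of x] y by blast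
    then have "nb y = {w}" by (intro nb_eqI) (use y in \<open>auto simp: N_adj[OF wy]\<close>)
    then have dy: "d y = 1" by (simp add: d_eq_card)
    have "- s1 = 1 / d w" using leaf_near[OF leaf wy y(1)] W2_empty[OF tri(4)[OF wy y(2,3)]] dy kp dpw by simp
    moreover have "1 / d w - s1 = 1" using np dpq dpw by simp
    ultimately have "1 / d w + 1 / d w = 1" by linarith
    then have "d w = 2" using dw_pos by (simp add: field_simps)
    then show False using tri(6) by simp
  qed
  have "nb w = {l, p, q}" by (rule nb_eqI) (use only wl p q in blast)
  then have dw3: "d w = 3" using p_ne_l q_ne_l p_ne_q by (simp add: d_eq_card)
  have zw: "z \<noteq> w" "z2 \<noteq> w" using z z2 by (auto simp: far_def)
  \<comment> \<open>Degree 3 leaves no room for further children of \<open>p\<close>, and below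
    likewise of \<open>q\<close>.\<close>
  have nbp: "{w, q, z} = nb p"
  proof (rule card_subset_eq)
    show "{w, q, z} \<subseteq> nb p" using adj_sym[OF p] pq(1) far_par_adj[OF z] zp by auto
    show "card {w, q, z} = card (nb p)" using dw3 dpw pq zq zw by (simp add: d_eq_card)
  qed simp
  have z2p: "p \<noteq> z2" using z2 p N_not_far by blast
  have nbq: "{w, p, z2} = nb q"
  proof (rule card_subset_eq)
    show "{w, p, z2} \<subseteq> nb q" using adj_sym[OF q] adj_sym[OF pq(1)] far_par_adj[OF z2] z2q by auto
    show "card {w, p, z2} = card (nb q)" using dw3 dpw dpq pq z2p zw by (simp add: d_eq_card)
  qed simp
  have far_only: "x = z \<or> x = z2" if x: "far x" for x
  proof -
    have "x \<noteq> w" "x \<noteq> p" "x \<noteq> q" using x p q by (auto simp: far_def)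
    moreover have "x \<in> nb p \<or> x \<in> nb q" using far_par_adj[OF x] triangle_far_par[OF p q x] by auto
    ultimately show ?thesis unfolding nbp[symmetric] nbq[symmetric] by auto
  qed
  have zV: "z \<in> V" "z2 \<in> V" using z z2 by (auto simp: far_def)
  have Vset: "V = set [w, p, q, l, z, z2]"
  proof
    show "V \<subseteq> set [w, p, q, l, z, z2]"
    proof
      fix x assume "x \<in> V"
      then have "x = w \<or> x \<in> {l, p, q} \<or> x = z \<or> x = z2" using V_cases[of x] only[of x] far_only[of x] by blast
      then show "x \<in> set [w, p, q, l, z, z2]" by auto
    qed
    show "set [w, p, q, l, z, z2] \<subseteq> V" using adj_V[OF p] adj_V[OF q] adj_V[OF wl] zV by auto
  qed
  have zadj: "E z x \<longleftrightarrow> x = p" "E z2 x \<longleftrightarrow> x = q" for x using nz nz2 nb_iff by blast+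
  have zne: "z \<noteq> p" "z \<noteq> l" "z2 \<noteq> l" "z2 \<noteq> q" using z z2 p q wl by (auto simp: far_def)
  have facts: "E w p" "E p w" "E w q" "E q w" "E w l" "E l w" "E p q" "E q p"
     "\<not> E l p" "\<not> E p l" "\<not> E l q" "\<not> E q l" "E z p" "E p z" "E z2 q" "E q z2"
     "\<not> E z w" "\<not> E w z" "\<not> E z2 w" "\<not> E w z2" "\<not> E z q" "\<not> E q z" "\<not> E z2 p" "\<not> E p z2"
     "\<not> E z l" "\<not> E l z" "\<not> E z2 l" "\<not> E l z2" "\<not> E z z2" "\<not> E z2 z"
  proof -
    show "E w p" "E w q" "E w l" "E p q" "\<not> E q z" "\<not> E p z2"
      using p q wl pq(1) qz pz2 by blast+
    show "E p w" "E q w" "E l w" "E q p" using p q wl pq(1) adj_sym by auto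
    show "\<not> E l p" "\<not> E l q" "\<not> E l z" "\<not> E l z2" using l_adj pq(2,3) zw by auto
    then show "\<not> E p l" "\<not> E q l" "\<not> E z l" "\<not> E z2 l" using adj_sym by blast+
    show "E z p" "E z2 q" "\<not> E z w" "\<not> E z2 w" "\<not> E z q" "\<not> E z2 p" "\<not> E z z2" "\<not> E z2 z"
      using zadj pq(2,3) p_ne_q zne z2p zq by auto
    then show "E p z" "E q z2" "\<not> E w z" "\<not> E w z2" using adj_sym by blast+
  qed
  let ?xs = "[w, p, q, l, z, z2]"
  show ?thesis
  proof (rule graph_isoI_distinct[OF Vset])
    have "w \<noteq> l" using wl by auto
    then show "distinct ?xs" using pq p_ne_q p_ne_l q_ne_l zne z2p zq zw zz2 by auto
    show "U4111_V = {0..<length ?xs}" by (auto simp: U4111_V_def)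
    fix i j assume "i < length ?xs" "j < length ?xs"
    then have "i \<in> {0, 1, 2, 3, 4, 5}" "j \<in> {0, 1, 2, 3, 4, 5}" by auto
    then show "E (?xs ! i) (?xs ! j) \<longleftrightarrow> U4111_E i j"
      using facts by (elim insertE emptyE; simp add: U4111_E_def doubleton_eq_iff)
  qed
qed

lemma extra_edge_in_first_level:
  assumes "E w p" "E w q"
  shows "graph_iso V E U21_V U21_E \<or> graph_iso V E U4111_V U4111_E"
proof (cases "\<exists>z. far z")
  case True
  then obtain z where z: "far z" by blast
  interpret swapped: leaf_tree V E k s1 s2 s3 l w par q p by (rule swap)
  show ?thesis
    using triangle_far_par[OF assms z] triangle_far_imp_U4111[OF assms z]
      swapped.triangle_far_imp_U4111[OF assms(2,1) z] by blast
next
  case False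
  then show ?thesis using triangle_no_far_imp_U21[OF assms] by blast
qed

lemma classification: "graph_iso V E U21_V U21_E \<or> graph_iso V E U4111_V U4111_E"
proof -
  interpret swapped: leaf_tree V E k s1 s2 s3 l w par q p by (rule swap)
  have "E w p \<or> far p" "E w q \<or> far q" using V_cases adj_V[OF pq(1)] pq(2,3) by auto
  then show ?thesis
    using extra_edge_in_first_level extra_edge_not_between_levels swapped.extra_edge_not_between_levels extra_edge_not_in_last_level by blast
qed

end

theorem theorem4p2:
  fixes V :: "'a set" and E :: "'a \<Rightarrow> 'a \<Rightarrow> bool"
  assumes "unicyclic V E"
  shows "card (nl_eigenvalues V E) = 4 \<longleftrightarrow>
           graph_iso V E (cycle_V 6) (cycle_E 6) \<or>
           graph_iso V E (cycle_V 7) (cycle_E 7) \<or>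
           graph_iso V E U21_V U21_E \<or>
           graph_iso V E U4111_V U4111_E"
proof -
  have simple: "simple_graph V E" and conn: "connected_graph V E" and ce: "card (edge_set E) = card V"
    using assms by (auto simp: unicyclic_def)
  have "V \<noteq> {}" "finite V" using simple conn by (auto simp: simple_graph_def connected_graph_def)
  then have "edge_set E \<noteq> {}" using ce by auto
  then interpret conn_graph V E using simple conn by unfold_locales
  have dpos: "degree V E u > 0" if "u \<in> V" for u using d_pos_V[OF that] by (simp add: d_def)
  have "nl_eigenvalues V E = (\<lambda>c. 1 - c) ` walk_eigenvalues V E"
    using fin dpos by (rule nl_eigenvalues_eq_walk_eigenvalues)
  then have card_eq: "card (nl_eigenvalues V E) = card (walk_eigenvalues V E)"
    by (simp add: card_image inj_on_def)
  show ?thesis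
  proof
    assume "card (nl_eigenvalues V E) = 4"
    then have four: "card (walk_eigenvalues V E) = 4" by (simp add: card_eq)
    show "graph_iso V E (cycle_V 6) (cycle_E 6) \<or> graph_iso V E (cycle_V 7) (cycle_E 7) \<or>
           graph_iso V E U21_V U21_E \<or> graph_iso V E U4111_V U4111_E"
    proof (cases "\<exists>l\<in>V. degree V E l = 1")
      case True
      then obtain l w where leaf: "nb l = {w}" by (auto simp: degree_def nb_def card_1_singleton_iff)
      obtain k s1 s2 s3 where k: "k \<noteq> 0" "\<forall>u\<in>V. \<forall>v\<in>V. W3 u v - s1 * W2 u v
           + s2 * (if E u v then 1 else 0) - s3 * (if u = v then d u else 0) = k * d u * d v"
        using four_eigenvalues_identity[OF four] by blast
      interpret cubic_walk_graph V E k s1 s2 s3 using k by unfold_locales auto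
      obtain par p q where "leaf_tree V E k s1 s2 s3 l w par p q"
      proof (rule leaf_tree_exists[OF leaf ce])
        fix par p q
        assume "\<And>v. E w v \<Longrightarrow> par v = w"
          "\<And>v. v \<in> V \<Longrightarrow> v \<noteq> w \<Longrightarrow> \<not> E w v \<Longrightarrow> E w (par v)"
          "E p q" "p \<noteq> w" "q \<noteq> w"
          "\<And>u v. E u v \<longleftrightarrow> u \<in> V \<and> v \<in> V \<and>
             ((u \<noteq> w \<and> v = par u) \<or> (v \<noteq> w \<and> u = par v) \<or> (u = p \<and> v = q) \<or> (u = q \<and> v = p))"
          "par p \<noteq> q" "par q \<noteq> p"
        with leaf have "leaf_tree V E k s1 s2 s3 l w par p q" by unfold_locales
        then show thesis by (rule that)
      qed
      then have "graph_iso V E U21_V U21_E \<or> graph_iso V E U4111_V U4111_E"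
        by (rule leaf_tree.classification)
      then show ?thesis by blast
    next
      case False
      have ge: "2 \<le> degree V E u" if "u \<in> V" for u using False dpos[OF that] that by force
      \<comment> \<open>As many edges as vertices means average degree 2; with all degrees at least
        2 the subtraction is exact and every degree equals 2.\<close>
      have "(\<Sum>u\<in>V. degree V E u - 2) = 0"
        using handshake ce sum_subtractf_nat[of V "\<lambda>_. 2" "degree V E"] ge by simp
      then have deg2: "degree V E u = 2" if "u \<in> V" for u using fin that ge[OF that] by force
      then have "card (nb u) = 2" if "u \<in> V" for u using that by (simp add: degree_def nb_def)
      then obtain n where n: "3 \<le> n" and iso: "graph_iso V E (cycle_V n) (cycle_E n)"
        using two_regular_iso_cycle by blast
      have c4: "card (walk_eigenvalues (cycle_V n) (cycle_E n)) = 4"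
        using four walk_eigenvalues_graph_iso[OF iso] by simp
      \<comment> \<open>An infinite set would have cardinality 0.\<close>
      then have "finite (walk_eigenvalues (cycle_V n) (cycle_E n))"
        by (intro card_ge_0_finite) simp
      then have "n div 2 + 1 \<le> 4" using card_walk_eigenvalues_cycle_ge[OF n] c4 by simp
      moreover have "n \<notin> {3, 4, 5}" using card_walk_eigenvalues_small_cycle c4 by fastforce
      ultimately have "n = 6 \<or> n = 7" using n by auto
      then show ?thesis using iso by blast
    qed
  next
    assume "graph_iso V E (cycle_V 6) (cycle_E 6) \<or> graph_iso V E (cycle_V 7) (cycle_E 7) \<or>
           graph_iso V E U21_V U21_E \<or> graph_iso V E U4111_V U4111_E"
    then show "card (nl_eigenvalues V E) = 4"
      unfolding card_eq
      by (elim disjE)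
         (simp_all add: walk_eigenvalues_graph_iso card_walk_eigenvalues_cycle_6_7
           card_walk_eigenvalues_U21 card_walk_eigenvalues_U4111)
  qed
qed

end
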